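(* There is an absolute constant $C>0$ such that the following holds for every integer $n \geq 1$ and every real $K \geq 2$. Suppose that $A \subseteq \operatorname{U}_n(\mathbb{C})$ is a $K$-approximate group. Then there is a connected abelian subgroup $S \subseteq \operatorname{U}_n(\mathbb{C})$ such that $A$ lies in the normaliser $N(S)$ of $S$ in $\operatorname{U}_n(\mathbb{C})$, and such that the image of $A$ under the quotient homomorphism $\pi : N(S) \rightarrow N(S)/S$ has cardinality at most $n^{Cn^4}K^{Cn^2}$.
   Context: $\operatorname{U}_n(\mathbb{C})$ is the group of $n \times n$ complex unitary matrices. For subsets $X, Y$ of a group, $XY := \{xy : x \in X, y \in Y\}$ and $A^2 := AA$. Approximate group: let $G$ be a group and $K \geq 1$. A finite subset $A \subseteq G$ is a $K$-approximate group if (i) $A$ is symmetric, i.e. $a \in A$ implies $a^{-1} \in A$, and the identity lies in $A$; and (ii) there is a symmetric subset $X \subseteq G$ with $|X| \leq K$ such that $A^2 \subseteq XA$. Here $G = \operatorname{U}_n(\mathbb{C})$. *)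

theory Defs
  imports
    "HOL-Analysis.Analysis"
    "HOL-Algebra.Zassenhaus"
    "Jordan_Normal_Form.Schur_Decomposition"
begin

text \<open>Matrices with an explicit dimension are used because the constant of the theorem is
  uniform in \<open>n\<close>.\<close>

definition unitary_group :: "nat \<Rightarrow> complex mat monoid" where
  "unitary_group n =
     \<lparr>carrier = {U \<in> carrier_mat n n. U * mat_adjoint U = 1\<^sub>m n \<and> mat_adjoint U * U = 1\<^sub>m n},
      monoid.mult = (*), one = 1\<^sub>m n\<rparr>"

text \<open>The subspace topology inherited from \<open>\<complex>\<^sup>n\<^sup>\<times>\<^sup>n\<close>. Only the entries with
  indices below \<open>n\<close> are used: \<open>$$\<close> is unspecified outside the matrix.\<close>

definition unitary_topology :: "nat \<Rightarrow> complex mat topology" where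
  "unitary_topology n =
     pullback_topology (carrier (unitary_group n))
       (\<lambda>U. \<lambda>ij \<in> {..<n} \<times> {..<n}. U $$ ij)
       (product_topology (\<lambda>_. euclidean) ({..<n} \<times> {..<n}))"

definition symmetric_subset :: "('a, 'b) monoid_scheme \<Rightarrow> 'a set \<Rightarrow> bool" where
  "symmetric_subset G X \<longleftrightarrow> X \<subseteq> carrier G \<and> (\<forall>x\<in>X. inv\<^bsub>G\<^esub> x \<in> X)"

definition approximate_group :: "('a, 'b) monoid_scheme \<Rightarrow> real \<Rightarrow> 'a set \<Rightarrow> bool" where
  "approximate_group G K A \<longleftrightarrow>
     1 \<le> K \<and> finite A \<and> symmetric_subset G A \<and> \<one>\<^bsub>G\<^esub> \<in> A \<and>
     (\<exists>X. symmetric_subset G X \<and> finite X \<and> real (card X) \<le> K \<and> A <#>\<^bsub>G\<^esub> A \<subseteq> X <#>\<^bsub>G\<^esub> A)"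

lemma mat_adjoint_carrier: "U \<in> carrier_mat n m \<Longrightarrow> mat_adjoint U \<in> carrier_mat m n"
  unfolding mat_adjoint_def by auto

lemma mat_adjoint_index:
  "i < dim_col U \<Longrightarrow> j < dim_row U \<Longrightarrow> mat_adjoint U $$ (i, j) = conjugate (U $$ (j, i))"
  unfolding mat_adjoint_def by (simp add: mat_of_rows_def)

lemma mat_adjoint_mult:
  fixes U V :: "complex mat"
  assumes U: "U \<in> carrier_mat n n" and V: "V \<in> carrier_mat n n"
  shows "mat_adjoint (U * V) = mat_adjoint V * mat_adjoint U"
proof (rule eq_matI)
  note c = mat_adjoint_carrier[OF U] mat_adjoint_carrier[OF V] mat_adjoint_carrier[of "U * V" n n]
  fix i j assume "i < dim_row (mat_adjoint V * mat_adjoint U)"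
    and "j < dim_col (mat_adjoint V * mat_adjoint U)"
  then have ij: "i < n" "j < n" using c by auto
  then show "mat_adjoint (U * V) $$ (i, j) = (mat_adjoint V * mat_adjoint U) $$ (i, j)"
    using U V c by (simp add: mat_adjoint_index scalar_prod_def mult.commute)
qed (use U V mat_adjoint_carrier[OF U] mat_adjoint_carrier[OF V] mat_adjoint_carrier[of "U * V" n n] in auto)

lemma mat_adjoint_adjoint:
  fixes U :: "complex mat"
  assumes U: "U \<in> carrier_mat n m"
  shows "mat_adjoint (mat_adjoint U) = U"
  using U mat_adjoint_carrier[OF U] mat_adjoint_carrier[OF mat_adjoint_carrier[OF U]]
  by (intro eq_matI) (auto simp: mat_adjoint_index)

lemma mat_adjoint_one: "mat_adjoint (1\<^sub>m n :: complex mat) = 1\<^sub>m n"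
  using mat_adjoint_carrier[of "1\<^sub>m n :: complex mat" n n]
  by (intro eq_matI) (auto simp: mat_adjoint_index)

lemma unitary_mult_aux:
  fixes U V :: "complex mat"
  assumes U: "U \<in> carrier_mat n n" and V: "V \<in> carrier_mat n n"
    and UU: "U * mat_adjoint U = 1\<^sub>m n" and VV: "V * mat_adjoint V = 1\<^sub>m n"
  shows "(U * V) * mat_adjoint (U * V) = 1\<^sub>m n"
proof -
  note c = mat_adjoint_carrier[OF U] mat_adjoint_carrier[OF V]
  have "(U * V) * mat_adjoint (U * V) = U * (V * (mat_adjoint V * mat_adjoint U))"
    using U V c by (simp add: mat_adjoint_mult[OF U V] assoc_mult_mat[of _ n n _ n _ n])
  also have "V * (mat_adjoint V * mat_adjoint U) = (V * mat_adjoint V) * mat_adjoint U"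
    using U V c by (simp add: assoc_mult_mat[of _ n n _ n _ n])
  finally show ?thesis using c UU VV by simp
qed

lemma unitary_mult_aux':
  fixes U V :: "complex mat"
  assumes U: "U \<in> carrier_mat n n" and V: "V \<in> carrier_mat n n"
    and UU: "mat_adjoint U * U = 1\<^sub>m n" and VV: "mat_adjoint V * V = 1\<^sub>m n"
  shows "mat_adjoint (U * V) * (U * V) = 1\<^sub>m n"
  using unitary_mult_aux[of "mat_adjoint V" n "mat_adjoint U"] U V UU VV
  by (simp add: mat_adjoint_carrier mat_adjoint_mult[of "mat_adjoint V" n "mat_adjoint U"]
      mat_adjoint_adjoint[OF U] mat_adjoint_adjoint[OF V] mat_adjoint_mult[OF U V])

lemma group_unitary_group: "group (unitary_group n)"
proof (rule groupI)
  fix U assume "U \<in> carrier (unitary_group n)"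
  then show "\<exists>V\<in>carrier (unitary_group n). V \<otimes>\<^bsub>unitary_group n\<^esub> U = \<one>\<^bsub>unitary_group n\<^esub>"
    by (intro bexI[of _ "mat_adjoint U"])
      (auto simp: unitary_group_def mat_adjoint_adjoint intro: mat_adjoint_carrier)
qed (auto simp: unitary_group_def mat_adjoint_one unitary_mult_aux unitary_mult_aux'
      intro: assoc_mult_mat)

lemma topspace_unitary_topology: "topspace (unitary_topology n) = carrier (unitary_group n)"
  by (auto simp: unitary_topology_def topspace_pullback_topology)

text \<open>Taking right cosets in the ambient group gives the quotient homomorphism
  \<open>N(S) \<rightarrow> N(S)/S\<close>, since \<open>#>\<close> does not depend on the carrier.\<close>

lemma (in group) r_coset_hom_normalizer:
  assumes "subgroup S G"
  shows "(\<lambda>a. S #> a) \<in> hom (G\<lparr>carrier := normalizer G S\<rparr>) (G\<lparr>carrier := normalizer G S\<rparr> Mod S)"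
  using normal.r_coset_hom_Mod[OF subgroup_in_normalizer[OF assms]] by (simp add: r_coset_def)

end

theory Submission
  imports Defs
begin

text \<open>Jordan's argument. Among the elements of \<open>A\<^sup>2\<close> near the identity that do not
  commute with all the others choose one, \<open>\<gamma>\<close>, that comes closest to doing so. Its commutators with them are much smaller still, hence
  lie in few classes, so \<open>\<gamma>\<close> commutes with a large part of \<open>A\<^sup>2\<close>. Iterating inside centralisers
  produces commuting elements that are linearly independent, so after at most \<open>n\<close> steps a large
  commuting set \<open>T \<subseteq> A\<^sup>2\<close> remains. Its double commutant is abelian, and \<open>A\<close> meets few of its cosets.
  The intersection of at most \<open>n + 1\<close> of its conjugates is normalised by \<open>A\<close>, again because a strictly
  decreasing chain yields linearly independent commuting matrices; this costs a further factor
  \<open>n\<close> in the exponents. The subgroup obtained is itself a commutant of unitary matrices, and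
  such commutants are connected.\<close>

section \<open>Approximate subgroups\<close>

text \<open>Smallness has to become exact commutation. Minimality of \<open>\<gamma>\<close> only
  shows that the quotient of two of its commutators, taken from one translate of \<open>A\<close>,
  commutes with all small elements. Such a quotient is itself a commutator of
  \<open>\<gamma>\<close> with an element near 1, and a trace identity makes it trivial because it
  commutes with \<open>\<gamma>\<close>. The exponents rest on chains of length at most
  \<open>n\<close>; independence in the space of matrices alone would give n^2. Independent
  commuting unitary matrices stay independent when applied to a suitable vector, which moves the
  count into an \<open>n\<close>-dimensional space. One descent to a centraliser costs
  \<open>N * K ^ 11\<close>, where \<open>N = (16 * n + 1) ^ (2 * n ^ 2)\<close> counts boxes of
  diameter at most 1/5 that cover the unitary group. At most \<open>n + 1\<close> descents and
  \<open>n + 1\<close> conjugates produce N to the power (n + 1)^2 and a power of \<open>K\<close>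
  of order n^2. The group generated by \<open>T\<close> is abelian too, but may be finite and hence
  disconnected. A commutant contains, with each \<open>u\<close>, a path to 1 whose points are
  rational expressions in \<open>u\<close> and its adjoint.\<close>

definition commutant :: "('a, 'b) monoid_scheme \<Rightarrow> 'a set \<Rightarrow> 'a set" where
  "commutant G Y = {g \<in> carrier G. \<forall>y\<in>Y. g \<otimes>\<^bsub>G\<^esub> y = y \<otimes>\<^bsub>G\<^esub> g}"

primrec set_pow :: "('a, 'b) monoid_scheme \<Rightarrow> 'a set \<Rightarrow> nat \<Rightarrow> 'a set" where
  "set_pow G A 0 = {\<one>\<^bsub>G\<^esub>}"
| "set_pow G A (Suc m) = set_pow G A m <#>\<^bsub>G\<^esub> A"

text \<open>A certificate of linear independence in group terms: \<open>y j\<close> commutes with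
  every \<open>g i\<close> for \<open>i < j\<close>, hence with their span, but not with
  \<open>g j\<close>. So in a matrix group no \<open>g j\<close> is a combination of the earlier
  ones.\<close>

definition commuting_chain ::
    "('a, 'b) monoid_scheme \<Rightarrow> (nat \<Rightarrow> 'a) \<Rightarrow> (nat \<Rightarrow> 'a) \<Rightarrow> nat \<Rightarrow> bool" where
  "commuting_chain G g y k \<longleftrightarrow>
     (\<forall>i<k. g i \<in> carrier G \<and> y i \<in> carrier G \<and> g i \<otimes>\<^bsub>G\<^esub> y i \<noteq> y i \<otimes>\<^bsub>G\<^esub> g i) \<and>
     (\<forall>i<k. \<forall>j<k. g i \<otimes>\<^bsub>G\<^esub> g j = g j \<otimes>\<^bsub>G\<^esub> g i) \<and>
     (\<forall>j<k. \<forall>i<j. g i \<otimes>\<^bsub>G\<^esub> y j = y j \<otimes>\<^bsub>G\<^esub> g i)"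

lemma set_mult_iff: "x \<in> P <#>\<^bsub>G\<^esub> Q \<longleftrightarrow> (\<exists>p\<in>P. \<exists>q\<in>Q. x = p \<otimes>\<^bsub>G\<^esub> q)"
  by (auto simp: set_mult_def)

section \<open>Word identities, commutants and product sets in a group\<close>

context group
begin

lemma l_inv_cancel: "x \<in> carrier G \<Longrightarrow> y \<in> carrier G \<Longrightarrow> inv x \<otimes> (x \<otimes> y) = y"
  by (simp add: m_assoc[symmetric])

lemma r_inv_cancel: "x \<in> carrier G \<Longrightarrow> y \<in> carrier G \<Longrightarrow> x \<otimes> (inv x \<otimes> y) = y"
  by (simp add: m_assoc[symmetric])

text \<open>As rewrite rules these reassociate to the right, push inverses inwards and cancel
  adjacent inverse pairs, so identities between group words become a matter of
  \<open>simp\<close>.\<close>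

lemmas group_normalize = m_assoc inv_mult_group l_inv_cancel r_inv_cancel

lemma commute_inv:
  assumes "x \<in> carrier G" "y \<in> carrier G" "x \<otimes> y = y \<otimes> x"
  shows "inv x \<otimes> y = y \<otimes> inv x"
proof -
  have "inv x \<otimes> y = inv x \<otimes> (y \<otimes> x) \<otimes> inv x" using assms(1,2) by (simp add: m_assoc)
  also have "\<dots> = inv x \<otimes> (x \<otimes> y) \<otimes> inv x" using assms(3) by simp
  also have "\<dots> = y \<otimes> inv x" using assms(1,2) by (simp add: l_inv_cancel)
  finally show ?thesis .
qed

lemma commute_mult:
  assumes "x \<in> carrier G" "y \<in> carrier G" "z \<in> carrier G"
    and "x \<otimes> z = z \<otimes> x" "y \<otimes> z = z \<otimes> y"
  shows "x \<otimes> y \<otimes> z = z \<otimes> (x \<otimes> y)"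
proof -
  have "x \<otimes> y \<otimes> z = x \<otimes> (z \<otimes> y)" using assms by (simp add: m_assoc)
  also have "\<dots> = (z \<otimes> x) \<otimes> y" using assms(1-3) by (simp add: m_assoc[symmetric] assms(4))
  finally show ?thesis using assms(1-3) by (simp add: m_assoc)
qed

lemma commute_via_commutator:
  assumes x: "x \<in> carrier G" and y: "y \<in> carrier G" and e: "x \<otimes> y \<otimes> inv x \<otimes> inv y = \<one>"
  shows "x \<otimes> y = y \<otimes> x"
proof -
  have "x \<otimes> y = (x \<otimes> y \<otimes> inv x \<otimes> inv y) \<otimes> (y \<otimes> x)" using x y by (simp add: group_normalize)
  then show ?thesis using x y e by simp
qed

lemma commuting_chain_extend:
  assumes ch: "commuting_chain G g y k" and x: "x \<in> carrier G" and z: "z \<in> carrier G"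
    and "x \<otimes> z \<noteq> z \<otimes> x"
    and "\<And>i. i < k \<Longrightarrow> g i \<otimes> x = x \<otimes> g i" "\<And>i. i < k \<Longrightarrow> g i \<otimes> z = z \<otimes> g i"
  shows "commuting_chain G (g(k := x)) (y(k := z)) (Suc k)"
  using assms unfolding commuting_chain_def by (auto simp: less_Suc_eq)

lemma subgroup_commutant:
  assumes "Y \<subseteq> carrier G"
  shows "subgroup (commutant G Y) G"
proof (rule subgroupI)
  show "commutant G Y \<noteq> {}" using assms by (auto simp: commutant_def intro!: exI[of _ \<one>])
  fix a assume a: "a \<in> commutant G Y"
  then show "inv a \<in> commutant G Y" using assms by (auto simp: commutant_def intro: commute_inv)
  fix b assume "b \<in> commutant G Y"
  with a show "a \<otimes> b \<in> commutant G Y"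
    using assms by (auto simp: commutant_def intro!: commute_mult)
qed (auto simp: commutant_def)

lemma set_pow_closed: "A \<subseteq> carrier G \<Longrightarrow> set_pow G A m \<subseteq> carrier G"
  by (induction m) (auto simp: set_mult_closed)

lemma set_pow_add:
  assumes A: "A \<subseteq> carrier G" and x: "x \<in> set_pow G A m" and y: "y \<in> set_pow G A k"
  shows "x \<otimes> y \<in> set_pow G A (m + k)"
  using y
proof (induction k arbitrary: y)
  case 0
  then show ?case using x set_pow_closed[OF A, of m] by (auto simp: subset_iff)
next
  case (Suc k)
  then obtain p a where p: "p \<in> set_pow G A k" "a \<in> A" "y = p \<otimes> a"
    by (auto simp: set_mult_iff)
  have "x \<otimes> y = (x \<otimes> p) \<otimes> a"
    using p x A set_pow_closed[OF A] by (simp add: m_assoc subset_iff)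
  then show ?case using Suc.IH[OF p(1)] p(2) by (auto simp: set_mult_iff)
qed

lemma set_pow_1: "A \<subseteq> carrier G \<Longrightarrow> set_pow G A (Suc 0) = A"
  by (force simp: set_mult_def subset_iff)

lemma r_coset_eq_iff:
  assumes "subgroup H G" "x \<in> carrier G" "y \<in> carrier G"
  shows "H #> x = H #> y \<longleftrightarrow> x \<otimes> inv y \<in> H"
proof
  note sub = subgroup.subset[OF assms(1)]
  assume "H #> x = H #> y"
  then have "H #> (x \<otimes> inv y) = H" using coset_mult_inv2 assms sub by blast
  then show "x \<otimes> inv y \<in> H" using coset_join1[of H "x \<otimes> inv y"] assms by simp
next
  assume "x \<otimes> inv y \<in> H"
  then have "H #> (x \<otimes> inv y) = H" using coset_join2[of "x \<otimes> inv y" H] assms by simp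
  then show "H #> x = H #> y" using coset_mult_inv1 assms subgroup.subset[OF assms(1)] by blast
qed

text \<open>Both directions are asked for because \<open>S\<close> may be infinite, where an
  inclusion of the conjugate in \<open>S\<close> does not imply equality.\<close>

lemma normalizerI:
  assumes S: "subgroup S G" and a: "a \<in> carrier G"
    and 1: "\<And>s. s \<in> S \<Longrightarrow> a \<otimes> s \<otimes> inv a \<in> S"
    and 2: "\<And>s. s \<in> S \<Longrightarrow> inv a \<otimes> s \<otimes> a \<in> S"
  shows "a \<in> normalizer G S"
proof -
  note Sc = subgroup.subset[OF S]
  have "a <# S #> inv a = S"
  proof
    show "a <# S #> inv a \<subseteq> S" using 1 by (auto simp: l_coset_def r_coset_def)
    show "S \<subseteq> a <# S #> inv a"
    proof
      fix s assume s: "s \<in> S"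
      then have "s = a \<otimes> (inv a \<otimes> s \<otimes> a) \<otimes> inv a"
        using a Sc by (simp add: group_normalize subset_iff)
      then show "s \<in> a <# S #> inv a" using 2[OF s] by (auto simp: l_coset_def r_coset_def)
    qed
  qed
  then show ?thesis using a Sc by (auto simp: normalizer_def stabilizer_def)
qed

end

section \<open>Covering and coset counting for powers of an approximate group\<close>

locale approx_group = group +
  fixes A :: "'a set" and K :: real
  assumes approx: "approximate_group G K A"
begin

lemma K_ge_1: "1 \<le> K" and finite_A: "finite A" and one_A: "\<one> \<in> A"
  and A_carrier: "A \<subseteq> carrier G" and inv_A: "a \<in> A \<Longrightarrow> inv a \<in> A"
  using approx by (auto simp: approximate_group_def symmetric_subset_def)

abbreviation pow :: "nat \<Rightarrow> 'a set" where "pow \<equiv> set_pow G A"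

lemmas pow_closed = set_pow_closed[OF A_carrier]
lemmas pow_add = set_pow_add[OF A_carrier]
lemmas pow_1 = set_pow_1[OF A_carrier]

lemma pow_carrier: "x \<in> pow m \<Longrightarrow> x \<in> carrier G"
  using pow_closed by auto

lemma one_pow: "\<one> \<in> pow m"
proof (induction m)
  case (Suc m)
  then show ?case using one_A set_mult_iff[of \<one> G "pow m" A] l_one[of \<one>]
    by (metis one_closed set_pow.simps(2))
qed auto

lemma pow_mono:
  assumes "m \<le> k"
  shows "pow m \<subseteq> pow k"
proof
  fix x assume "x \<in> pow m"
  then show "x \<in> pow k" using pow_add[of x m \<one> "k - m"] one_pow assms pow_carrier by auto
qed

lemma A_in_pow: "a \<in> A \<Longrightarrow> a \<in> pow (Suc 0)"
  using pow_1 by simp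

lemma inv_pow: "x \<in> pow m \<Longrightarrow> inv x \<in> pow m"
proof (induction m arbitrary: x)
  case (Suc m)
  then obtain p a where p: "p \<in> pow m" "a \<in> A" "x = p \<otimes> a"
    by (auto simp: set_mult_iff)
  then have "inv x = inv a \<otimes> inv p" using A_carrier pow_carrier by (auto intro!: inv_mult_group)
  then show ?case
    using pow_add[OF A_in_pow[OF inv_A[OF p(2)]] Suc.IH[OF p(1)]] by simp
qed auto

lemma finite_pow: "finite (pow m)"
proof (induction m)
  case (Suc m)
  have "pow (Suc m) = (\<lambda>(p, a). p \<otimes> a) ` (pow m \<times> A)" by (auto simp: set_mult_def)
  then show ?case using Suc finite_A by (metis finite_SigmaI finite_imageI)
qed auto

text \<open>Every factor after the first is absorbed by one use of
  \<open>A <#> A \<subseteq> X <#> A\<close>, which multiplies the set of translates by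
  \<open>X\<close> on the right.\<close>

lemma pow_cover:
  "\<exists>Z. finite Z \<and> Z \<subseteq> carrier G \<and> real (card Z) \<le> K ^ m \<and> pow (Suc m) \<subseteq> Z <#> A"
proof (induction m)
  case 0
  show ?case
    using pow_1 A_carrier by (intro exI[of _ "{\<one>}"]) (auto simp: set_mult_iff subset_iff)
next
  case (Suc m)
  then obtain Z where Z: "finite Z" "Z \<subseteq> carrier G" "real (card Z) \<le> K ^ m" "pow (Suc m) \<subseteq> Z <#> A"
    by blast
  obtain X where X: "X \<subseteq> carrier G" "finite X" "real (card X) \<le> K" "A <#> A \<subseteq> X <#> A"
    using approx by (auto simp: approximate_group_def symmetric_subset_def)
  have "pow (Suc (Suc m)) \<subseteq> (Z <#> A) <#> A"
    using Z(4) by (metis mono_set_mult order_refl set_pow.simps(2))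
  also have "\<dots> = Z <#> (A <#> A)" using Z(2) A_carrier set_mult_assoc by auto
  also have "\<dots> \<subseteq> Z <#> (X <#> A)" using X(4) by (metis mono_set_mult order_refl)
  also have "\<dots> = (Z <#> X) <#> A" using Z(2) X(1) A_carrier set_mult_assoc by auto
  finally have 1: "pow (Suc (Suc m)) \<subseteq> (Z <#> X) <#> A" .
  have ZX: "Z <#> X = (\<lambda>(p, a). p \<otimes> a) ` (Z \<times> X)" by (auto simp: set_mult_def)
  have "card (Z <#> X) \<le> card Z * card X"
    unfolding ZX using card_image_le[of "Z \<times> X"] Z(1) X(2) by (simp add: card_cartesian_product)
  then have "real (card (Z <#> X)) \<le> real (card Z) * real (card X)"
    by (metis of_nat_le_iff of_nat_mult)
  also have "\<dots> \<le> K ^ m * K" using Z(3) X(3) K_ge_1 by (intro mult_mono) auto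
  finally have "real (card (Z <#> X)) \<le> K ^ Suc m" by (simp add: mult.commute)
  moreover have "finite (Z <#> X)" unfolding ZX using Z(1) X(2) by auto
  moreover have "Z <#> X \<subseteq> carrier G" by (rule set_mult_closed[OF Z(2) X(1)])
  ultimately show ?case using 1 by (intro exI[of _ "Z <#> X"] conjI)
qed

lemma card_pow_le: "real (card (pow (Suc m))) \<le> K ^ m * card A"
proof -
  obtain Z where Z: "finite Z" "Z \<subseteq> carrier G" "real (card Z) \<le> K ^ m" "pow (Suc m) \<subseteq> Z <#> A"
    using pow_cover by blast
  have eq: "Z <#> A = (\<lambda>(p, a). p \<otimes> a) ` (Z \<times> A)" by (auto simp: set_mult_def)
  have "card (pow (Suc m)) \<le> card (Z <#> A)"
    using Z(1,4) finite_A unfolding eq by (intro card_mono) auto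
  also have "\<dots> \<le> card Z * card A"
    unfolding eq using card_image_le[of "Z \<times> A"] Z(1) finite_A by (simp add: card_cartesian_product)
  finally have "real (card (pow (Suc m))) \<le> real (card Z) * real (card A)"
    by (metis of_nat_le_iff of_nat_mult)
  also have "\<dots> \<le> K ^ m * card A" using Z(3) by (intro mult_right_mono) auto
  finally show ?thesis .
qed

text \<open>Two elements \<open>c \<otimes> a\<close> and \<open>c \<otimes> b\<close> of one
  translate have the left quotient \<open>inv a \<otimes> b\<close>, whatever \<open>c\<close> is.
  This is what brings quotients of long products back into \<open>pow 2\<close>. The set
  \<open>F\<close> only indexes the products, and \<open>g\<close> may identify indices.\<close>

lemma translate_pigeonhole:
  assumes F: "finite F" and g: "\<And>x. x \<in> F \<Longrightarrow> g x \<in> pow (Suc m)"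
  shows "\<exists>F'\<subseteq>F. real (card F) \<le> K ^ m * card F' \<and> (\<forall>x\<in>F'. \<forall>y\<in>F'. inv (g x) \<otimes> g y \<in> pow 2)"
proof (cases "F = {}")
  case False
  obtain Z where Z: "finite Z" "Z \<subseteq> carrier G" "real (card Z) \<le> K ^ m" "pow (Suc m) \<subseteq> Z <#> A"
    using pow_cover by blast
  then have "\<forall>x\<in>F. \<exists>z\<in>Z. \<exists>a\<in>A. g x = z \<otimes> a" using g by (auto simp: set_mult_iff subset_iff)
  then obtain z where z: "\<forall>x\<in>F. z x \<in> Z \<and> (\<exists>a\<in>A. g x = z x \<otimes> a)" by metis
  have "Z \<noteq> {}" using z False by auto
  then obtain c where c: "card F \<le> card (z -` {c} \<inter> F) * card Z"
    using pigeonhole_card[of z F Z] z F Z(1) by auto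
  define F' where "F' = z -` {c} \<inter> F"
  have "real (card F) \<le> real (card Z) * card F'"
    using c unfolding F'_def by (metis mult.commute of_nat_le_iff of_nat_mult)
  also have "\<dots> \<le> K ^ m * card F'" using Z(3) by (intro mult_right_mono) auto
  finally have 1: "real (card F) \<le> K ^ m * card F'" .
  have "inv (g x) \<otimes> g y \<in> pow 2" if xy: "x \<in> F'" "y \<in> F'" for x y
  proof -
    obtain a b where ab: "a \<in> A" "b \<in> A" "g x = c \<otimes> a" "g y = c \<otimes> b"
      using xy z unfolding F'_def by (metis IntE vimage_singleton_eq)
    have "c \<in> carrier G" using xy z Z(2) unfolding F'_def by auto
    then have "inv (g x) \<otimes> g y = inv a \<otimes> b"
      using ab A_carrier by (simp add: group_normalize subset_iff)
    also have "\<dots> \<in> pow 2"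
      using pow_add[OF A_in_pow[OF inv_A[OF ab(1)]] A_in_pow[OF ab(2)]] by (simp add: numeral_2_eq_2)
    finally show ?thesis .
  qed
  then show ?thesis using 1 unfolding F'_def by blast
qed auto

text \<open>Multiplying one representative of each coset by the elements of
  \<open>pow 2 \<inter> H\<close> gives pairwise distinct elements of \<open>pow (m + 2)\<close>. A
  large intersection with \<open>H\<close> therefore forces few cosets.\<close>

lemma card_cosets_mult_le:
  assumes H: "subgroup H G" and P: "P \<subseteq> pow m"
  shows "card ((\<lambda>x. H #> x) ` P) * card (pow 2 \<inter> H) \<le> card (pow (m + 2))"
proof -
  define r where "r C = (SOME x. x \<in> P \<and> H #> x = C)" for C
  have r: "r C \<in> P \<and> H #> r C = C" if "C \<in> (\<lambda>x. H #> x) ` P" for C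
    unfolding r_def by (rule someI_ex) (use that in auto)
  let ?D = "(\<lambda>x. H #> x) ` P \<times> (pow 2 \<inter> H)"
  let ?f = "\<lambda>(C, b). b \<otimes> r C"
  have rP: "r C \<in> carrier G" if "C \<in> (\<lambda>x. H #> x) ` P" for C using r[OF that] P pow_carrier by auto
  have coset: "H #> (b \<otimes> r C) = C" if "C \<in> (\<lambda>x. H #> x) ` P" "b \<in> H" for C b
  proof -
    have "b \<in> carrier G" using that(2) H subgroup.mem_carrier by fastforce
    then have "H #> (b \<otimes> r C) = (H #> b) #> r C"
      using rP[OF that(1)] coset_mult_assoc subgroup.subset[OF H] by auto
    then show ?thesis using coset_join2[OF \<open>b \<in> carrier G\<close> H that(2)] r[OF that(1)] by simp
  qed
  have "inj_on ?f ?D"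
  proof (rule inj_onI, clarify)
    fix x x' b b'
    assume a: "x \<in> P" "b \<in> pow 2" "b \<in> H" "x' \<in> P" "b' \<in> pow 2" "b' \<in> H"
      "b \<otimes> r (H #> x) = b' \<otimes> r (H #> x')"
    then have e: "H #> x = H #> x'" using coset[of "H #> x" b] coset[of "H #> x'" b'] by auto
    have "b = b'" using a(7) unfolding e using rP[of "H #> x'"] a pow_carrier by auto
    then show "H #> x = H #> x' \<and> b = b'" using e by simp
  qed
  moreover have "?f ` ?D \<subseteq> pow (m + 2)"
    using r P pow_add[of _ 2 _ m] by (fastforce simp: add.commute)
  ultimately have "card ?D \<le> card (pow (m + 2))" using finite_pow card_inj_on_le by blast
  then show ?thesis by (simp add: card_cartesian_product)
qed

end

section \<open>Finding a large commuting set\<close>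

text \<open>All that is used about unitary matrices: \<open>\<nu>\<close> is the distance to the
  identity, \<open>N\<close> the covering number at scale 1/5, and \<open>d\<close> bounds the
  length of commuting chains. The radius 1/5 is below 1/4: commutators of small elements have
  \<open>\<nu>\<close> at most 2/25, quotients of two of these at most 4/25, so they are small
  again, and one more commutator contracts by the factor 4/5.\<close>

locale small_commutators = approx_group +
  fixes \<nu> :: "'a \<Rightarrow> real" and N :: real and d :: nat
  assumes nu_eq_0: "x \<in> carrier G \<Longrightarrow> \<nu> x = 0 \<Longrightarrow> x = \<one>"
    and nu_nonneg: "x \<in> carrier G \<Longrightarrow> 0 \<le> \<nu> x"
    and nu_quotient: "x \<in> carrier G \<Longrightarrow> y \<in> carrier G \<Longrightarrow> \<nu> (inv x \<otimes> y) \<le> \<nu> x + \<nu> y"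
    and nu_commutator: "x \<in> carrier G \<Longrightarrow> y \<in> carrier G \<Longrightarrow>
      \<nu> (x \<otimes> y \<otimes> inv x \<otimes> inv y) \<le> 2 * \<nu> x * \<nu> y"
    and central_commutator: "x \<in> carrier G \<Longrightarrow> w \<in> carrier G \<Longrightarrow> \<nu> w < 1 \<Longrightarrow>
      c = x \<otimes> w \<otimes> inv x \<otimes> inv w \<Longrightarrow> c \<otimes> x = x \<otimes> c \<Longrightarrow> c = \<one>"
    and N_ge_1: "1 \<le> N"
    and nu_cover: "finite F \<Longrightarrow> F \<subseteq> carrier G \<Longrightarrow>
      \<exists>F'\<subseteq>F. real (card F) \<le> N * card F' \<and> (\<forall>x\<in>F'. \<forall>y\<in>F'. \<nu> (inv x \<otimes> y) \<le> 1/5)"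
    and chain_bound: "commuting_chain G g h k \<Longrightarrow> k \<le> d"
begin

text \<open>Two pigeonholes are needed. The first, at cost \<open>N\<close>, makes quotients small;
  the second, at cost \<open>K\<close>, makes them lie in \<open>pow 2\<close> rather than in
  \<open>pow 4\<close>. Dividing by one fixed element then maps the remaining set injectively into
  the small elements.\<close>

lemma small_elements_large:
  assumes H: "subgroup H G"
  shows "real (card (pow 2 \<inter> H)) \<le> N * K * real (card {b \<in> pow 2 \<inter> H. \<nu> b \<le> 1/5})" (is "_ \<le> _ * real (card ?T)")
proof -
  have Bc: "pow 2 \<inter> H \<subseteq> carrier G" using pow_closed by blast
  obtain F where F: "F \<subseteq> pow 2 \<inter> H" "real (card (pow 2 \<inter> H)) \<le> N * card F"
    "\<forall>x\<in>F. \<forall>y\<in>F. \<nu> (inv x \<otimes> y) \<le> 1/5"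
    using nu_cover[of "pow 2 \<inter> H"] finite_pow Bc by auto
  have finF: "finite F" using F(1) finite_pow by (meson finite_Int finite_subset)
  obtain F' where F': "F' \<subseteq> F" "real (card F) \<le> K ^ 1 * card F'"
    "\<forall>x\<in>F'. \<forall>y\<in>F'. inv x \<otimes> y \<in> pow 2"
    using translate_pigeonhole[of F "\<lambda>x. x" 1] finF F(1) by (auto simp: numeral_2_eq_2)
  have "card F' \<le> card ?T"
  proof (cases "F' = {}")
    case False
    then obtain f where f: "f \<in> F'" by auto
    have F'H: "F' \<subseteq> H" "F' \<subseteq> carrier G" using F'(1) F(1) Bc by auto
    have "(\<lambda>y. inv f \<otimes> y) ` F' \<subseteq> ?T"
    proof
      fix z assume "z \<in> (\<lambda>y. inv f \<otimes> y) ` F'"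
      then obtain y where y: "y \<in> F'" "z = inv f \<otimes> y" by auto
      have "z \<in> H" using y F'H f H by (auto intro!: subgroup.m_closed subgroup.m_inv_closed)
      moreover have "\<nu> z \<le> 1/5" using y f F'(1) F(3) by blast
      ultimately show "z \<in> ?T" using y f F'(3) by auto
    qed
    moreover have "inj_on (\<lambda>y. inv f \<otimes> y) F'"
      using f F'H(2) by (intro inj_onI) (auto simp: subset_iff)
    moreover have "finite ?T" using finite_pow by simp
    ultimately show ?thesis using card_inj_on_le by blast
  qed auto
  then have "real (card F') \<le> card ?T" by simp
  then have "N * (K * card F') \<le> N * (K * card ?T)" using N_ge_1 K_ge_1 by (intro mult_left_mono) auto
  moreover have "N * card F \<le> N * (K * card F')" using F'(2) N_ge_1 by (intro mult_left_mono) auto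
  ultimately show ?thesis using F(2) by (simp add: mult.assoc)
qed

text \<open>The element \<open>\<gamma>\<close> minimises the largest commutator with the small elements \<open>T\<close>. Commutators of
  \<open>\<gamma>\<close> with \<open>T\<close> are much smaller, so two of them that lie in one translate of \<open>A\<close> differ by an
  element that violates minimality unless it centralises \<open>T\<close>.\<close>

lemma commuting_or_centralizer_large:
  assumes H: "subgroup H G"
  defines "T \<equiv> {b \<in> pow 2 \<inter> H. \<nu> b \<le> 1/5}"
  shows "(\<forall>x\<in>T. \<forall>y\<in>T. x \<otimes> y = y \<otimes> x) \<or>
    (\<exists>\<gamma>\<in>T. \<exists>y\<in>T. \<gamma> \<otimes> y \<noteq> y \<otimes> \<gamma> \<and>
       real (card T) \<le> K ^ 10 * card (pow 2 \<inter> (H \<inter> commutant G {\<gamma>})))"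
proof (cases "\<forall>x\<in>T. \<forall>y\<in>T. x \<otimes> y = y \<otimes> x")
  case False
  have finT: "finite T" unfolding T_def using finite_pow by auto
  have Tc: "x \<in> carrier G" "x \<in> H" "x \<in> pow 2" "\<nu> x \<le> 1/5" if "x \<in> T" for x
    using that pow_carrier unfolding T_def by auto
  define cm where "cm x y = x \<otimes> y \<otimes> inv x \<otimes> inv y" for x y
  define M where "M g = Max ((\<lambda>b. \<nu> (cm g b)) ` T)" for g
  have M_ge: "\<nu> (cm g b) \<le> M g" if "b \<in> T" for g b unfolding M_def using that finT by auto
  have M_ex: "\<exists>b\<in>T. M g = \<nu> (cm g b)" for g
  proof -
    have "M g \<in> (\<lambda>b. \<nu> (cm g b)) ` T" unfolding M_def using finT False by (intro Max_in) auto
    then show ?thesis by auto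
  qed
  define P where "P = {g \<in> T. \<exists>b\<in>T. g \<otimes> b \<noteq> b \<otimes> g}"
  have P: "finite P" "P \<noteq> {}" using finT False unfolding P_def by auto
  define \<gamma> where "\<gamma> = arg_min_on M P"
  have \<gamma>P: "\<gamma> \<in> P" and min: "\<And>g. g \<in> P \<Longrightarrow> M \<gamma> \<le> M g"
    using arg_min_if_finite[OF P, of M] unfolding \<gamma>_def by (auto simp: not_less)
  then obtain y0 where \<gamma>T: "\<gamma> \<in> T" and y0: "y0 \<in> T" "\<gamma> \<otimes> y0 \<noteq> y0 \<otimes> \<gamma>" unfolding P_def by auto
  have "cm \<gamma> y0 \<noteq> \<one>" using commute_via_commutator Tc(1) \<gamma>T y0 unfolding cm_def by blast
  then have "0 < \<nu> (cm \<gamma> y0)"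
    using nu_eq_0[of "cm \<gamma> y0"] nu_nonneg[of "cm \<gamma> y0"] Tc(1) \<gamma>T y0(1) unfolding cm_def by fastforce
  then have M_pos: "0 < M \<gamma>" using M_ge[OF y0(1), of \<gamma>] by simp
  \<comment> \<open>This bound guarantees that the quotient \<open>c\<close> of two commutators
    below, with \<open>\<nu> c \<le> 2 * M \<gamma>\<close>, belongs to \<open>T\<close>, so that
    minimality can be applied to it.\<close>
  have M_small: "M \<gamma> \<le> 2/25"
  proof -
    obtain b where b: "b \<in> T" "M \<gamma> = \<nu> (cm \<gamma> b)" using M_ex by blast
    have "\<nu> (cm \<gamma> b) \<le> 2 * \<nu> \<gamma> * \<nu> b" using nu_commutator Tc(1) b(1) \<gamma>T unfolding cm_def by blast
    also have "\<dots> \<le> 2 * (1/5) * (1/5)"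
      using Tc(1,4)[OF b(1)] Tc(1,4)[OF \<gamma>T] nu_nonneg by (intro mult_mono) auto
    finally show ?thesis using b(2) by simp
  qed
  \<comment> \<open>Four factors from \<open>pow 2\<close>; the exponent 7 is what the pigeonhole
    pays for \<open>pow 8\<close>.\<close>
  have cm_pow: "cm \<gamma> x \<in> pow (Suc 7)" if "x \<in> T" for x
  proof -
    have "cm \<gamma> x \<in> pow (2 + 2 + 2 + 2)"
      unfolding cm_def using Tc(3) that \<gamma>T by (intro pow_add inv_pow)
    then show ?thesis by (simp add: eval_nat_numeral)
  qed
  obtain T' where T': "T' \<subseteq> T" "real (card T) \<le> K ^ 7 * card T'"
    "\<forall>x\<in>T'. \<forall>y\<in>T'. inv (cm \<gamma> x) \<otimes> cm \<gamma> y \<in> pow 2"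
    using translate_pigeonhole[of T "cm \<gamma>" 7] finT cm_pow by blast
  have comm: "\<gamma> \<otimes> (inv x \<otimes> y) = (inv x \<otimes> y) \<otimes> \<gamma>" if xy: "x \<in> T'" "y \<in> T'" for x y
  proof -
    have xyT: "x \<in> T" "y \<in> T" using xy T'(1) by auto
    note car [simp] = Tc(1)[OF xyT(1)] Tc(1)[OF xyT(2)] Tc(1)[OF \<gamma>T]
    have cmc [simp]: "cm \<gamma> x \<in> carrier G" "cm \<gamma> y \<in> carrier G" unfolding cm_def by auto
    define w where "w = inv x \<otimes> y"
    have wc [simp]: "w \<in> carrier G" unfolding w_def by simp
    define c where "c = inv (cm \<gamma> x) \<otimes> cm \<gamma> y"
    have cc [simp]: "c \<in> carrier G" unfolding c_def by simp
    have "\<nu> c \<le> \<nu> (cm \<gamma> x) + \<nu> (cm \<gamma> y)" unfolding c_def by (intro nu_quotient cmc)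
    then have nu_c: "\<nu> c \<le> 2 * M \<gamma>" using M_ge[OF xyT(1), of \<gamma>] M_ge[OF xyT(2), of \<gamma>] by linarith
    have "c \<in> H"
      unfolding c_def cm_def using Tc(2) xyT \<gamma>T H
      by (intro subgroup.m_closed[OF H] subgroup.m_inv_closed[OF H])
    moreover have "c \<in> pow 2" unfolding c_def using T'(3) xy by blast
    ultimately have cT: "c \<in> T" using nu_c M_small unfolding T_def by auto
    have cen: "c \<otimes> b = b \<otimes> c" if b: "b \<in> T" for b
    proof (rule ccontr)
      assume "c \<otimes> b \<noteq> b \<otimes> c"
      then have "c \<in> P" using cT b unfolding P_def by auto
      then have le: "M \<gamma> \<le> M c" by (rule min)
      obtain e where e: "e \<in> T" "M c = \<nu> (cm c e)" using M_ex by blast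
      \<comment> \<open>The bound is 4/5 of \<open>M \<gamma>\<close>, so \<open>c\<close> would
        come closer to centralising \<open>T\<close> than \<open>\<gamma>\<close> does.\<close>
      have "\<nu> (cm c e) \<le> 2 * \<nu> c * \<nu> e" using nu_commutator Tc(1) e(1) unfolding cm_def by simp
      also have "\<dots> \<le> 2 * (2 * M \<gamma>) * (1/5)"
        using nu_c Tc(1,4)[OF e(1)] nu_nonneg M_pos by (intro mult_mono) auto
      finally have "M c < M \<gamma>" using e(2) M_pos by simp
      then show False using le by simp
    qed
    \<comment> \<open>A quotient of two commutators with \<open>\<gamma>\<close> is a conjugate, by
      \<open>x\<close>, of the commutator of \<open>\<gamma>\<close> with \<open>w\<close>. As
      \<open>c\<close> commutes with \<open>x\<close>, the conjugation disappears.\<close>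
    have eq: "c \<otimes> x = x \<otimes> (\<gamma> \<otimes> w \<otimes> inv \<gamma> \<otimes> inv w)"
      unfolding c_def cm_def w_def by (simp add: group_normalize)
    then have "x \<otimes> c = x \<otimes> (\<gamma> \<otimes> w \<otimes> inv \<gamma> \<otimes> inv w)" using cen[OF xyT(1)] by simp
    then have c_eq: "c = \<gamma> \<otimes> w \<otimes> inv \<gamma> \<otimes> inv w" by simp
    have "\<nu> w < 1"
      using nu_quotient[of x y] Tc(4)[OF xyT(1)] Tc(4)[OF xyT(2)] unfolding w_def by simp
    then have "c = \<one>" using central_commutator[of \<gamma> w c] c_eq cen[OF \<gamma>T] by simp
    then show ?thesis using commute_via_commutator[of \<gamma> w] c_eq unfolding w_def by simp
  qed
  have "card T > 0" using finT \<gamma>T by (auto simp: card_gt_0_iff)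
  then have "T' \<noteq> {}" using T'(2) by auto
  then obtain x0 where x0: "x0 \<in> T'" by auto
  then have x0T: "x0 \<in> T" using T'(1) by auto
  have finT': "finite T'" using T'(1) finT finite_subset by blast
  \<comment> \<open>Quotients within \<open>T'\<close> commute with \<open>\<gamma>\<close> but are
    only known to lie in \<open>pow 4\<close>. A second pigeonhole puts them into
    \<open>pow 2\<close>; the translation by \<open>x0\<close> cancels in the quotients. The total
    cost is \<open>K ^ 7 * K ^ 3\<close>.\<close>
  have "inv x0 \<otimes> y \<in> pow (Suc 3)" if "y \<in> T'" for y
    using pow_add[OF inv_pow[OF Tc(3)[OF x0T]] Tc(3)[of y]] that T'(1) by (auto simp: eval_nat_numeral)
  then obtain T'' where T'': "T'' \<subseteq> T'" "real (card T') \<le> K ^ 3 * card T''"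
    "\<forall>x\<in>T''. \<forall>y\<in>T''. inv (inv x0 \<otimes> x) \<otimes> (inv x0 \<otimes> y) \<in> pow 2"
    using translate_pigeonhole[of T' "\<lambda>y. inv x0 \<otimes> y" 3] finT' by blast
  let ?B = "pow 2 \<inter> (H \<inter> commutant G {\<gamma>})"
  have "card T'' \<le> card ?B"
  proof (cases "T'' = {}")
    case False
    then obtain f where f: "f \<in> T''" by auto
    have T''T: "x \<in> T" if "x \<in> T''" for x using that T''(1) T'(1) by auto
    have "(\<lambda>y. inv f \<otimes> y) ` T'' \<subseteq> ?B"
    proof
      fix z assume "z \<in> (\<lambda>y. inv f \<otimes> y) ` T''"
      then obtain y where y: "y \<in> T''" "z = inv f \<otimes> y" by auto
      note car [simp] = Tc(1)[OF T''T[OF y(1)]] Tc(1)[OF T''T[OF f]] Tc(1)[OF x0T] Tc(1)[OF \<gamma>T]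
      have "inv (inv x0 \<otimes> f) \<otimes> (inv x0 \<otimes> y) = z" using y(2) by (simp add: group_normalize)
      then have "z \<in> pow 2" using T''(3) f y(1) by metis
      moreover have "z \<in> H"
        unfolding y(2) using Tc(2)[OF T''T] f y(1)
        by (intro subgroup.m_closed[OF H] subgroup.m_inv_closed[OF H])
      moreover have "z \<in> commutant G {\<gamma>}"
        using comm[of f y] f y T''(1) by (auto simp: commutant_def subset_iff)
      ultimately show "z \<in> ?B" by auto
    qed
    moreover have "inj_on (\<lambda>y. inv f \<otimes> y) T''"
      using f Tc(1)[OF T''T] by (intro inj_onI) auto
    ultimately show ?thesis using finite_pow by (meson card_inj_on_le finite_Int)
  qed auto
  then have "K ^ 7 * (K ^ 3 * card T'') \<le> K ^ 7 * (K ^ 3 * card ?B)"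
    using K_ge_1 by (intro mult_left_mono) auto
  moreover have "K ^ 7 * card T' \<le> K ^ 7 * (K ^ 3 * card T'')"
    using T''(2) K_ge_1 by (intro mult_left_mono) auto
  ultimately have "real (card T) \<le> K ^ 7 * (K ^ 3 * card ?B)" using T'(2) by linarith
  then have "real (card T) \<le> K ^ 10 * card ?B" by (simp add: mult.assoc[symmetric] power_add[symmetric])
  then show ?thesis using \<gamma>T y0 by blast
qed auto

text \<open>A descent through centralisers in which \<open>H\<close> is the commutant of the
  elements found so far. Passing to the small elements costs \<open>N * K\<close>, passing to the
  centraliser of the next element costs \<open>K ^ 10\<close>. Unless the small elements of
  \<open>H\<close> already commute, the chain grows, with a second small element of \<open>H\<close>
  as the witness.\<close>

lemma large_commuting_set:
  "\<exists>T\<subseteq>pow 2. (\<forall>x\<in>T. \<forall>y\<in>T. x \<otimes> y = y \<otimes> x) \<and> real (card A) \<le> (N * K ^ 11) ^ Suc d * card T"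
proof -
  define Q where "Q = N * K ^ 11"
  have K11: "K * K ^ 10 = K ^ 11" by (simp add: power_Suc[symmetric] del: power_Suc)
  have "K \<le> K ^ 11" using K_ge_1 self_le_power[of K 11] by simp
  then have NKQ: "N * K \<le> Q" unfolding Q_def using N_ge_1 by simp
  have Q: "1 \<le> Q" unfolding Q_def using N_ge_1 K_ge_1
    by (metis mult_mono' mult_1 one_le_power zero_le_one)
  define good where "good k \<longleftrightarrow> (\<exists>T\<subseteq>pow 2. (\<forall>x\<in>T. \<forall>y\<in>T. x \<otimes> y = y \<otimes> x) \<and>
      real (card A) \<le> Q ^ k * card T)" for k
  have "good k \<or> (\<exists>g y. commuting_chain G g y k \<and>
      real (card A) \<le> Q ^ k * card (pow 2 \<inter> commutant G (g ` {..<k})))" for k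
  proof (induction k)
    case 0
    have "commutant G {} = carrier G" by (auto simp: commutant_def)
    moreover have "A \<subseteq> pow 2" using A_in_pow pow_mono[of "Suc 0" 2] by auto
    ultimately have "card A \<le> card (pow 2 \<inter> commutant G {})"
      using pow_closed finite_pow by (intro card_mono) (auto simp: subset_iff)
    then show ?case by (auto simp: commuting_chain_def)
  next
    case (Suc k)
    show ?case
    proof (cases "good k")
      case True
      then obtain T where T: "T \<subseteq> pow 2" "\<forall>x\<in>T. \<forall>y\<in>T. x \<otimes> y = y \<otimes> x"
        "real (card A) \<le> Q ^ k * card T" unfolding good_def by blast
      have "Q ^ k * card T \<le> Q ^ Suc k * card T"
        using Q by (intro mult_right_mono power_increasing) auto
      then have "good (Suc k)" unfolding good_def using T by (meson order_trans)
      then show ?thesis by simp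
    next
      case False
      then obtain g y where ch: "commuting_chain G g y k"
        and cd: "real (card A) \<le> Q ^ k * card (pow 2 \<inter> commutant G (g ` {..<k}))"
        using Suc.IH by blast
      define H where "H = commutant G (g ` {..<k})"
      have H: "subgroup H G"
        unfolding H_def using ch by (intro subgroup_commutant) (auto simp: commuting_chain_def)
      define T where "T = {b \<in> pow 2 \<inter> H. \<nu> b \<le> 1/5}"
      have "Q ^ k * card (pow 2 \<inter> H) \<le> Q ^ k * (N * K * card T)"
        unfolding T_def using small_elements_large[OF H] Q by (intro mult_left_mono) auto
      then have cd2: "real (card A) \<le> Q ^ k * (N * K * card T)"
        using cd unfolding H_def by linarith
      consider (comm) "\<forall>x\<in>T. \<forall>y\<in>T. x \<otimes> y = y \<otimes> x"
        | (big) \<gamma> z where "\<gamma> \<in> T" "z \<in> T" "\<gamma> \<otimes> z \<noteq> z \<otimes> \<gamma>"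
          "real (card T) \<le> K ^ 10 * card (pow 2 \<inter> (H \<inter> commutant G {\<gamma>}))"
        using commuting_or_centralizer_large[OF H] unfolding T_def by blast
      then show ?thesis
      proof cases
        case comm
        have "Q ^ k * (N * K * card T) \<le> Q ^ k * (Q * card T)"
          using NKQ Q by (intro mult_left_mono mult_right_mono) auto
        then have "real (card A) \<le> Q ^ Suc k * card T" using cd2 by (simp add: mult_ac)
        then have "good (Suc k)" unfolding good_def using comm by (intro exI[of _ T]) (auto simp: T_def)
        then show ?thesis by simp
      next
        case big
        let ?g = "g(k := \<gamma>)"
        have T_H: "x \<in> carrier G \<and> x \<in> H" if "x \<in> T" for x using that pow_carrier unfolding T_def by auto
        have "g i \<otimes> x = x \<otimes> g i" if "i < k" "x \<in> T" for i x
          using T_H[OF that(2)] that(1) unfolding H_def by (auto simp: commutant_def)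
        then have ch': "commuting_chain G ?g (y(k := z)) (Suc k)"
          using ch big T_H by (intro commuting_chain_extend) auto
        have "?g ` {..<Suc k} = insert \<gamma> (g ` {..<k})" by (auto simp: lessThan_Suc)
        then have HH: "H \<inter> commutant G {\<gamma>} = commutant G (?g ` {..<Suc k})"
          unfolding H_def by (auto simp: commutant_def)
        have "Q ^ k * (N * K * card T) \<le> Q ^ k * (N * K * (K ^ 10 * card (pow 2 \<inter> (H \<inter> commutant G {\<gamma>}))))"
          using big(4) Q N_ge_1 K_ge_1 by (intro mult_left_mono) auto
        also have "\<dots> = Q ^ Suc k * card (pow 2 \<inter> commutant G (?g ` {..<Suc k}))"
          unfolding HH Q_def K11[symmetric] by (simp add: mult_ac)
        finally show ?thesis using cd2 ch' by (meson order_trans)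
      qed
    qed
  qed
  \<comment> \<open>The other alternative would be a commuting chain of length
    \<open>Suc d\<close>.\<close>
  from this[of "Suc d"] have "good (Suc d)" using chain_bound by fastforce
  then show ?thesis unfolding good_def Q_def .
qed

text \<open>While some \<open>a \<in> A\<close> does not normalise the current intersection of conjugates of \<open>S\<^sub>0\<close>, one
  further conjugate makes it strictly smaller, which lengthens a commuting chain.\<close>

lemma normalized_commutant:
  assumes T: "T \<subseteq> pow 2" "\<And>x y. x \<in> T \<Longrightarrow> y \<in> T \<Longrightarrow> x \<otimes> y = y \<otimes> x"
    and M: "0 \<le> M" "real (card A) \<le> M * real (card T)"
  shows "\<exists>Y\<subseteq>carrier G. A \<subseteq> normalizer G (commutant G Y) \<and>
    (\<forall>u\<in>commutant G Y. \<forall>v\<in>commutant G Y. u \<otimes> v = v \<otimes> u) \<and>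
    real (card ((\<lambda>a. commutant G Y #> a) ` A)) \<le> (K ^ (2 * d + 4) * M) ^ Suc d"
proof -
  have Tc: "T \<subseteq> carrier G" using T(1) pow_closed by blast
  define Y0 where "Y0 = commutant G T"
  define S0 where "S0 = commutant G Y0"
  have Y0c: "Y0 \<subseteq> carrier G" unfolding Y0_def by (auto simp: commutant_def)
  have S0: "subgroup S0 G" unfolding S0_def by (rule subgroup_commutant[OF Y0c])
  have TY0: "T \<subseteq> Y0" using T(2) Tc unfolding Y0_def by (auto simp: commutant_def)
  have TS0: "T \<subseteq> S0" using Tc unfolding S0_def Y0_def by (auto simp: commutant_def)
  have S0ab: "u \<otimes> v = v \<otimes> u" if "u \<in> S0" "v \<in> S0" for u v
  proof -
    \<comment> \<open>Since \<open>T\<close> is commutative it lies in its own commutant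
      \<open>Y0\<close>; the commutant of \<open>Y0\<close> is therefore contained in that of
      \<open>T\<close>, which is \<open>Y0\<close> again.\<close>
    have "v \<in> Y0" using that(2) TY0 unfolding S0_def Y0_def by (auto simp: commutant_def subset_iff)
    then show ?thesis using that(1) unfolding S0_def by (auto simp: commutant_def)
  qed
  define b where "b = real (card (pow 2 \<inter> S0))"
  have b_pos: "0 < b" unfolding b_def using one_pow finite_pow subgroup.one_closed[OF S0]
    by (auto simp: card_gt_0_iff)
  have "card T \<le> card (pow 2 \<inter> S0)" using T(1) TS0 finite_pow by (intro card_mono) auto
  then have "M * card T \<le> M * b" unfolding b_def using M(1) by (intro mult_left_mono) auto
  then have Ab: "real (card A) \<le> M * b" using M(2) by linarith
  \<comment> \<open>The commutant of \<open>conj w\<close> is the conjugate of \<open>S0\<close> by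
    \<open>w\<close>. Taking unions of the sets \<open>conj w\<close> thus intersects conjugates of
    \<open>S0\<close> while keeping the result a commutant.\<close>
  define conj where "conj w = (\<lambda>t. w \<otimes> t \<otimes> inv w) ` Y0" for w
  have conj_c: "conj w \<subseteq> carrier G" if "w \<in> carrier G" for w
    using that Y0c unfolding conj_def by auto
  have conj_iff: "(\<forall>y\<in>conj w. u \<otimes> y = y \<otimes> u) \<longleftrightarrow> (\<forall>t\<in>Y0. (inv w \<otimes> u \<otimes> w) \<otimes> t = t \<otimes> (inv w \<otimes> u \<otimes> w))"
    if "w \<in> carrier G" "u \<in> carrier G" for w u
  proof -
    have "u \<otimes> (w \<otimes> t \<otimes> inv w) = (w \<otimes> t \<otimes> inv w) \<otimes> u \<longleftrightarrow>
        (inv w \<otimes> u \<otimes> w) \<otimes> t = t \<otimes> (inv w \<otimes> u \<otimes> w)" if t: "t \<in> carrier G" for t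
    proof -
      have "u \<otimes> (w \<otimes> t \<otimes> inv w) = w \<otimes> ((inv w \<otimes> u \<otimes> w) \<otimes> t) \<otimes> inv w"
        "(w \<otimes> t \<otimes> inv w) \<otimes> u = w \<otimes> (t \<otimes> (inv w \<otimes> u \<otimes> w)) \<otimes> inv w"
        using t \<open>w \<in> carrier G\<close> \<open>u \<in> carrier G\<close> by (simp_all add: group_normalize)
      then show ?thesis using t \<open>w \<in> carrier G\<close> \<open>u \<in> carrier G\<close> by simp
    qed
    then show ?thesis using Y0c unfolding conj_def by (auto simp: subset_iff)
  qed
  \<comment> \<open>For \<open>w\<close> in \<open>pow k\<close> the conjugates of \<open>A\<close>
    lie in \<open>pow (2 * k + 1)\<close>, and coset counting adds 2. This costs
    \<open>K ^ (2 * k + 2)\<close>, and \<open>k\<close> is at most \<open>Suc d\<close>.\<close>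
  define Q where "Q = K ^ (2 * d + 4) * M"
  have idx_conj: "real (card ((\<lambda>a. commutant G (conj w) #> a) ` A)) \<le> Q"
    if w: "w \<in> pow k" "k \<le> Suc d" for w k
  proof -
    have wc [simp]: "w \<in> carrier G" using w pow_carrier by auto
    let ?P = "(\<lambda>a. inv w \<otimes> a \<otimes> w) ` A"
    have PP: "?P \<subseteq> pow (k + Suc 0 + k)"
      using pow_add[OF pow_add[OF inv_pow[OF w(1)] A_in_pow] w(1)] by blast
    have sub: "subgroup (commutant G (conj w)) G" by (rule subgroup_commutant[OF conj_c[OF wc]])
    \<comment> \<open>Conjugation by \<open>w\<close> carries cosets of \<open>S0\<close> to cosets
      of its conjugate. The description by \<open>THE\<close> is justified by \<open>key\<close>,
      the independence of the representative \<open>a\<close>.\<close>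
    define \<phi> where "\<phi> C = (THE D. \<exists>a\<in>A. C = S0 #> (inv w \<otimes> a \<otimes> w) \<and> D = commutant G (conj w) #> a)" for C
    have key: "commutant G (conj w) #> a = commutant G (conj w) #> a'"
      if a: "a \<in> A" "a' \<in> A" "S0 #> (inv w \<otimes> a \<otimes> w) = S0 #> (inv w \<otimes> a' \<otimes> w)" for a a'
    proof -
      have ac [simp]: "a \<in> carrier G" "a' \<in> carrier G" using a A_carrier by auto
      have "(inv w \<otimes> a \<otimes> w) \<otimes> inv (inv w \<otimes> a' \<otimes> w) \<in> S0"
        using r_coset_eq_iff[OF S0, THEN iffD1, OF _ _ a(3)] by simp
      then have "inv w \<otimes> (a \<otimes> inv a') \<otimes> w \<in> S0" by (simp add: group_normalize)
      then have "a \<otimes> inv a' \<in> commutant G (conj w)"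
        using conj_iff[of w "a \<otimes> inv a'"] unfolding S0_def by (auto simp: commutant_def)
      then show ?thesis using r_coset_eq_iff[OF sub] by simp
    qed
    have "\<phi> (S0 #> (inv w \<otimes> a \<otimes> w)) = commutant G (conj w) #> a" if "a \<in> A" for a
      unfolding \<phi>_def using key that by (intro the_equality) blast+
    then have "(\<lambda>a. commutant G (conj w) #> a) ` A \<subseteq> \<phi> ` ((\<lambda>x. S0 #> x) ` ?P)"
      by (force simp: image_iff)
    then have "card ((\<lambda>a. commutant G (conj w) #> a) ` A) \<le> card ((\<lambda>x. S0 #> x) ` ?P)"
      using finite_A by (intro surj_card_le) auto
    then have "real (card ((\<lambda>a. commutant G (conj w) #> a) ` A)) * b
        \<le> real (card ((\<lambda>x. S0 #> x) ` ?P)) * b"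
      using b_pos by (intro mult_right_mono) auto
    also have "\<dots> \<le> real (card (pow (k + Suc 0 + k + 2)))"
      unfolding b_def using card_cosets_mult_le[OF S0 PP] by (metis of_nat_le_iff of_nat_mult)
    also have "k + Suc 0 + k + 2 = Suc (2 * k + 2)" by simp
    also have "real (card (pow (Suc (2 * k + 2)))) \<le> K ^ (2 * k + 2) * card A" by (rule card_pow_le)
    also have "\<dots> \<le> K ^ (2 * d + 4) * (M * b)"
      using Ab K_ge_1 w(2) by (intro mult_mono power_increasing) auto
    also have "\<dots> = Q * b" unfolding Q_def by simp
    finally show ?thesis using b_pos by simp
  qed
  define Y where "Y W = (\<Union>w\<in>W. conj w)" for W
  have Yc: "Y W \<subseteq> carrier G" if "W \<subseteq> pow k" for W k
    using that conj_c pow_carrier unfolding Y_def by blast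
  have idx_int: "card ((\<lambda>a. commutant G (Y (insert w W)) #> a) ` A)
      \<le> card ((\<lambda>a. commutant G (Y W) #> a) ` A) * card ((\<lambda>a. commutant G (conj w) #> a) ` A)"
    if W: "W \<subseteq> pow k" "w \<in> pow (Suc k)" for W w k
  proof -
    define C1 where "C1 = commutant G (Y W)"
    define C2 where "C2 = commutant G (conj w)"
    define C where "C = commutant G (Y (insert w W))"
    have CC: "C = C1 \<inter> C2" unfolding C_def C1_def C2_def Y_def by (auto simp: commutant_def)
    have wc: "w \<in> carrier G" using pow_carrier[OF W(2)] .
    have s: "subgroup C1 G" "subgroup C2 G"
      unfolding C1_def C2_def using Yc[OF W(1)] conj_c[OF wc] by (auto intro: subgroup_commutant)
    have sC: "subgroup C G" unfolding CC by (rule subgroups_Inter_pair[OF s])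
    \<comment> \<open>A coset of the intersection is determined by the pair of cosets of
      \<open>C1\<close> and \<open>C2\<close>, so the indices multiply.\<close>
    define \<phi> where "\<phi> D = (THE E. \<exists>a\<in>A. D = (C1 #> a, C2 #> a) \<and> E = C #> a)" for D
    have key: "C #> a = C #> a'" if "a \<in> A" "a' \<in> A" "C1 #> a = C1 #> a'" "C2 #> a = C2 #> a'" for a a'
    proof -
      have ac: "a \<in> carrier G" "a' \<in> carrier G" using that A_carrier by auto
      have "a \<otimes> inv a' \<in> C" using that(3,4)
        unfolding r_coset_eq_iff[OF s(1) ac] r_coset_eq_iff[OF s(2) ac] CC by simp
      then show ?thesis unfolding r_coset_eq_iff[OF sC ac] .
    qed
    have "\<phi> (C1 #> a, C2 #> a) = C #> a" if "a \<in> A" for a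
      unfolding \<phi>_def using key that by (intro the_equality) blast+
    then have "(\<lambda>a. C #> a) ` A \<subseteq> \<phi> ` (((\<lambda>a. C1 #> a) ` A) \<times> ((\<lambda>a. C2 #> a) ` A))"
      by (force simp: image_iff)
    then have "card ((\<lambda>a. C #> a) ` A) \<le> card (((\<lambda>a. C1 #> a) ` A) \<times> ((\<lambda>a. C2 #> a) ` A))"
      using finite_A by (intro surj_card_le) auto
    then show ?thesis unfolding C_def C1_def C2_def by (simp add: card_cartesian_product)
  qed
  have Q1: "0 \<le> Q" unfolding Q_def using M K_ge_1 by simp
  have Q_ge_1: "1 \<le> Q"
  proof -
    have "0 < card ((\<lambda>a. commutant G (conj \<one>) #> a) ` A)"
      using one_A finite_A by (auto simp: card_gt_0_iff)
    then have "1 \<le> real (card ((\<lambda>a. commutant G (conj \<one>) #> a) ` A))" by linarith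
    then show ?thesis using idx_conj[of \<one> 0] one_pow by auto
  qed
  have conj_one: "conj \<one> = Y0" unfolding conj_def using Y0c by (auto simp: subset_iff image_iff)
  define good where "good k \<longleftrightarrow> (\<exists>W k'. W \<subseteq> pow k' \<and> \<one> \<in> W \<and> A \<subseteq> normalizer G (commutant G (Y W)) \<and>
      real (card ((\<lambda>a. commutant G (Y W) #> a) ` A)) \<le> Q ^ k)" for k
  \<comment> \<open>Here \<open>W\<close> stands for \<open>k + 1\<close> conjugates, which explains
    \<open>Q ^ Suc k\<close>. Keeping the identity in \<open>W\<close> keeps the commutant of
    \<open>Y W\<close> inside the abelian group \<open>S0\<close>. Each \<open>u j\<close> is taken
    from the intersection reached after \<open>j\<close> steps, so it commutes with the earlier
    \<open>y i\<close>, and \<open>y j\<close> witnesses that the next conjugate excludes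
    it.\<close>
  have "good k \<or> (\<exists>W u y. W \<subseteq> pow k \<and> \<one> \<in> W \<and>
      real (card ((\<lambda>a. commutant G (Y W) #> a) ` A)) \<le> Q ^ Suc k \<and>
      (\<forall>i<k. u i \<in> S0 \<and> y i \<in> Y W \<and> u i \<otimes> y i \<noteq> y i \<otimes> u i) \<and>
      (\<forall>j<k. \<forall>i<j. u j \<otimes> y i = y i \<otimes> u j))" if "k \<le> Suc d" for k
    using that
  proof (induction k)
    case 0
    have "Y {\<one>} = conj \<one>" unfolding Y_def by simp
    then show ?case using idx_conj[of \<one> 0] one_pow by (intro disjI2 exI[of _ "{\<one>}"]) auto
  next
    case (Suc k)
    show ?case
    proof (cases "good k")
      case True
      have "Q ^ k \<le> Q ^ Suc k" using Q_ge_1 by (intro power_increasing) auto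
      then have "good (Suc k)" using True unfolding good_def by (meson order_trans)
      then show ?thesis by simp
    next
      case False
      then obtain W u y where W: "W \<subseteq> pow k" "\<one> \<in> W"
        "real (card ((\<lambda>a. commutant G (Y W) #> a) ` A)) \<le> Q ^ Suc k"
        and uy: "\<forall>i<k. u i \<in> S0 \<and> y i \<in> Y W \<and> u i \<otimes> y i \<noteq> y i \<otimes> u i"
          "\<forall>j<k. \<forall>i<j. u j \<otimes> y i = y i \<otimes> u j"
        using Suc by auto
      show ?thesis
      proof (cases "A \<subseteq> normalizer G (commutant G (Y W))")
        case True
        then have "good (Suc k)" unfolding good_def using W by blast
        then show ?thesis by simp
      next
        case nn: False
        have Wc: "W \<subseteq> carrier G" using W(1) pow_closed by blast
        have sub: "subgroup (commutant G (Y W)) G" by (rule subgroup_commutant[OF Yc[OF W(1)]])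
        \<comment> \<open>If multiplying the elements of \<open>W\<close> by \<open>a\<close>
          imposed no new condition, conjugation by the inverse of \<open>a\<close> would preserve
          the commutant for each \<open>a\<close> in \<open>A\<close>; by symmetry of
          \<open>A\<close> this is normalisation.\<close>
        have "\<exists>a\<in>A. \<exists>v\<in>commutant G (Y W). \<exists>w\<in>W. \<exists>z\<in>conj (a \<otimes> w). v \<otimes> z \<noteq> z \<otimes> v"
        proof (rule ccontr)
          assume "\<not> ?thesis"
          then have all: "v \<otimes> z = z \<otimes> v"
            if "a \<in> A" "v \<in> commutant G (Y W)" "w \<in> W" "z \<in> conj (a \<otimes> w)" for a v w z
            using that by blast
          have st: "inv a \<otimes> v \<otimes> a \<in> commutant G (Y W)"
            if a: "a \<in> A" and v: "v \<in> commutant G (Y W)" for a v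
          proof -
            have c [simp]: "a \<in> carrier G" "v \<in> carrier G"
              using a v A_carrier by (auto simp: commutant_def)
            have "\<forall>z\<in>conj w. (inv a \<otimes> v \<otimes> a) \<otimes> z = z \<otimes> (inv a \<otimes> v \<otimes> a)" if w: "w \<in> W" for w
            proof -
              have wc [simp]: "w \<in> carrier G" using w Wc by auto
              have "\<forall>z\<in>conj (a \<otimes> w). v \<otimes> z = z \<otimes> v" using all a v w by blast
              then have "\<forall>t\<in>Y0. (inv (a \<otimes> w) \<otimes> v \<otimes> (a \<otimes> w)) \<otimes> t = t \<otimes> (inv (a \<otimes> w) \<otimes> v \<otimes> (a \<otimes> w))"
                using conj_iff[of "a \<otimes> w" v] by simp
              moreover have "inv (a \<otimes> w) \<otimes> v \<otimes> (a \<otimes> w) = inv w \<otimes> (inv a \<otimes> v \<otimes> a) \<otimes> w"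
                by (simp add: group_normalize)
              ultimately show ?thesis using conj_iff[of w "inv a \<otimes> v \<otimes> a"] by simp
            qed
            then show ?thesis unfolding Y_def commutant_def by auto
          qed
          have "A \<subseteq> normalizer G (commutant G (Y W))"
          proof
            fix a assume a: "a \<in> A"
            then have ac: "a \<in> carrier G" using A_carrier by auto
            show "a \<in> normalizer G (commutant G (Y W))"
              using st[OF a] st[OF inv_A[OF a]] ac by (intro normalizerI[OF sub ac]) auto
          qed
          then show False using nn by blast
        qed
        then obtain a v w z where a: "a \<in> A" "v \<in> commutant G (Y W)" "w \<in> W"
          "z \<in> conj (a \<otimes> w)" "v \<otimes> z \<noteq> z \<otimes> v" by blast
        let ?w = "a \<otimes> w"
        have w': "?w \<in> pow (Suc k)" using pow_add[OF A_in_pow[OF a(1)], of w k] a(3) W(1) by auto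
        let ?W = "insert ?w W"
        have "?W \<subseteq> pow (Suc k)" using w' W(1) pow_mono[of k "Suc k"] by auto
        moreover have "\<one> \<in> ?W" using W(2) by simp
        moreover have "real (card ((\<lambda>a. commutant G (Y ?W) #> a) ` A)) \<le> Q ^ Suc (Suc k)"
        proof -
          have "real (card ((\<lambda>a. commutant G (Y ?W) #> a) ` A)) \<le>
              real (card ((\<lambda>a. commutant G (Y W) #> a) ` A)) * real (card ((\<lambda>a. commutant G (conj ?w) #> a) ` A))"
            using idx_int[OF W(1) w'] by (metis of_nat_le_iff of_nat_mult)
          also have "\<dots> \<le> Q ^ Suc k * Q"
            using W(3) idx_conj[OF w'] Suc.prems Q1 by (intro mult_mono) auto
          finally show ?thesis by (simp add: mult.commute)
        qed
        moreover have "\<forall>i<Suc k. (u(k := v)) i \<in> S0 \<and> (y(k := z)) i \<in> Y ?W \<and>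
            (u(k := v)) i \<otimes> (y(k := z)) i \<noteq> (y(k := z)) i \<otimes> (u(k := v)) i"
        proof -
          have "Y0 \<subseteq> Y W" using W(2) conj_one unfolding Y_def by blast
          then have "v \<in> S0" using a(2) unfolding S0_def by (auto simp: commutant_def)
          moreover have "z \<in> Y ?W" "Y W \<subseteq> Y ?W" using a(4) unfolding Y_def by auto
          ultimately show ?thesis using uy(1) a(5) by (auto simp: less_Suc_eq)
        qed
        moreover have "\<forall>j<Suc k. \<forall>i<j. (u(k := v)) j \<otimes> (y(k := z)) i = (y(k := z)) i \<otimes> (u(k := v)) j"
          using uy a(2) by (auto simp: less_Suc_eq commutant_def)
        ultimately show ?thesis by blast
      qed
    qed
  qed
  from this[of "Suc d", OF order_refl] have "good (Suc d)"
  proof (elim disjE exE conjE)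
    fix W u y
    assume W: "W \<subseteq> pow (Suc d)"
      and uy: "\<forall>i<Suc d. u i \<in> S0 \<and> y i \<in> Y W \<and> u i \<otimes> y i \<noteq> y i \<otimes> u i"
        "\<forall>j<Suc d. \<forall>i<j. u j \<otimes> y i = y i \<otimes> u j"
    \<comment> \<open>The order is reversed: here the later \<open>u j\<close> commute with the
      earlier \<open>y i\<close>, whereas a chain asks the earlier elements to commute with the
      later witnesses.\<close>
    have "commuting_chain G (\<lambda>i. u (d - i)) (\<lambda>i. y (d - i)) (Suc d)"
      unfolding commuting_chain_def
    proof (intro conjI allI impI)
      fix i assume "i < Suc d"
      then have *: "d - i < Suc d" by simp
      show "u (d - i) \<in> carrier G" "y (d - i) \<in> carrier G"
        "u (d - i) \<otimes> y (d - i) \<noteq> y (d - i) \<otimes> u (d - i)"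
        using uy(1)[rule_format, OF *] Yc[OF W] subgroup.subset[OF S0] by auto
      fix j assume "j < Suc d"
      show "u (d - i) \<otimes> u (d - j) = u (d - j) \<otimes> u (d - i)"
        using uy(1) S0ab by simp
    next
      fix j i assume "j < Suc d" "i < j"
      then show "u (d - i) \<otimes> y (d - j) = y (d - j) \<otimes> u (d - i)" using uy(2) by auto
    qed
    then show ?thesis using chain_bound by fastforce
  qed auto
  then obtain W k' where W: "W \<subseteq> pow k'" "\<one> \<in> W" "A \<subseteq> normalizer G (commutant G (Y W))"
    "real (card ((\<lambda>a. commutant G (Y W) #> a) ` A)) \<le> Q ^ Suc d" unfolding good_def by blast
  have "Y0 \<subseteq> Y W" using W(2) conj_one unfolding Y_def by blast
  then have "commutant G (Y W) \<subseteq> S0" unfolding S0_def by (auto simp: commutant_def)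
  then have "\<forall>u\<in>commutant G (Y W). \<forall>v\<in>commutant G (Y W). u \<otimes> v = v \<otimes> u" using S0ab by auto
  then show ?thesis using W(3,4) Yc[OF W(1)] unfolding Q_def by (intro exI[of _ "Y W"] conjI)
qed

lemma almost_abelian:
  "\<exists>Y\<subseteq>carrier G. A \<subseteq> normalizer G (commutant G Y) \<and>
    (\<forall>u\<in>commutant G Y. \<forall>v\<in>commutant G Y. u \<otimes> v = v \<otimes> u) \<and>
    real (card ((\<lambda>a. commutant G Y #> a) ` A)) \<le> (K ^ (2 * d + 4) * (N * K ^ 11) ^ Suc d) ^ Suc d"
proof -
  obtain T where T: "T \<subseteq> pow 2" "\<forall>x\<in>T. \<forall>y\<in>T. x \<otimes> y = y \<otimes> x"
    "real (card A) \<le> (N * K ^ 11) ^ Suc d * card T"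
    using large_commuting_set by blast
  have "0 \<le> (N * K ^ 11) ^ Suc d" using N_ge_1 K_ge_1 by simp
  then show ?thesis using normalized_commutant[of T "(N * K ^ 11) ^ Suc d"] T by blast
qed

end

section \<open>The Frobenius norm on unitary matrices\<close>

definition frob_inner :: "complex mat \<Rightarrow> complex mat \<Rightarrow> complex" where
  "frob_inner A B = (\<Sum>i<dim_row A. \<Sum>j<dim_col A. cnj (A $$ (i, j)) * B $$ (i, j))"

definition frob :: "complex mat \<Rightarrow> real" where
  "frob A = L2_set (\<lambda>ij. cmod (A $$ ij)) ({..<dim_row A} \<times> {..<dim_col A})"

lemma frob_nonneg: "0 \<le> frob A"
  unfolding frob_def by (rule L2_set_nonneg)

lemma frob_sq: "(frob A)\<^sup>2 = (\<Sum>i<dim_row A. \<Sum>j<dim_col A. (cmod (A $$ (i, j)))\<^sup>2)"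
  unfolding frob_def L2_set_def by (simp add: sum_nonneg sum.cartesian_product)

lemma frob_inner_self: "frob_inner A A = complex_of_real ((frob A)\<^sup>2)"
  unfolding frob_inner_def frob_sq
  by (simp add: complex_norm_square mult.commute del: of_real_power)

lemma frob_eq_0:
  assumes "A \<in> carrier_mat n m" "frob A = 0"
  shows "A = 0\<^sub>m n m"
proof (rule eq_matI)
  fix i j assume ij: "i < dim_row (0\<^sub>m n m)" "j < dim_col (0\<^sub>m n m)"
  have "(\<Sum>ij\<in>{..<n}\<times>{..<m}. (cmod (A $$ ij))\<^sup>2) = 0"
    using assms unfolding frob_def L2_set_def by (auto simp: sum_nonneg)
  then have "(cmod (A $$ (i, j)))\<^sup>2 = 0"
    using ij by (subst (asm) sum_nonneg_eq_0_iff) auto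
  then show "A $$ (i, j) = 0\<^sub>m n m $$ (i, j)" using ij by simp
qed (use assms in auto)

lemma frob_inner_le:
  assumes A: "A \<in> carrier_mat n m" and B: "B \<in> carrier_mat n m"
  shows "cmod (frob_inner A B) \<le> frob A * frob B"
proof -
  have "cmod (frob_inner A B) = cmod (\<Sum>ij\<in>{..<n}\<times>{..<m}. cnj (A $$ ij) * B $$ ij)"
    unfolding frob_inner_def using A by (simp add: sum.cartesian_product split_def)
  also have "\<dots> \<le> (\<Sum>ij\<in>{..<n}\<times>{..<m}. cmod (cnj (A $$ ij) * B $$ ij))" by (rule norm_sum)
  also have "\<dots> = (\<Sum>ij\<in>{..<n}\<times>{..<m}. \<bar>cmod (A $$ ij)\<bar> * \<bar>cmod (B $$ ij)\<bar>)"
    by (simp add: norm_mult)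
  also have "\<dots> \<le> frob A * frob B" using L2_set_mult_ineq[of "\<lambda>ij. cmod (A $$ ij)" "\<lambda>ij. cmod (B $$ ij)"]
    unfolding frob_def using A B by (simp del: abs_norm_cancel)
  finally show ?thesis .
qed

lemma frob_diff_le:
  assumes "A \<in> carrier_mat n m" "B \<in> carrier_mat n m"
  shows "frob (A - B) \<le> frob A + frob B"
proof -
  have "frob (A - B) \<le> L2_set (\<lambda>ij. cmod (A $$ ij) + cmod (B $$ ij)) ({..<n} \<times> {..<m})"
    unfolding frob_def using assms by (auto intro!: L2_set_mono simp: norm_triangle_ineq4)
  also have "\<dots> \<le> frob A + frob B"
    unfolding frob_def using assms L2_set_triangle_ineq by auto
  finally show ?thesis .
qed

lemma mat_mult_index:
  assumes "A \<in> carrier_mat n m" "B \<in> carrier_mat m p" "i < n" "j < p"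
  shows "(A * B) $$ (i, j) = (\<Sum>k<m. A $$ (i, k) * B $$ (k, j))"
  using assms by (auto simp: scalar_prod_def lessThan_atLeast0)

lemma frob_mult_le:
  assumes A: "A \<in> carrier_mat n m" and B: "B \<in> carrier_mat m p"
  shows "frob (A * B) \<le> frob A * frob B"
proof (rule power2_le_imp_le)
  have "(frob (A * B))\<^sup>2 = (\<Sum>i<n. \<Sum>j<p. (cmod (\<Sum>k<m. A $$ (i, k) * B $$ (k, j)))\<^sup>2)"
    unfolding frob_sq using A B
    by (auto intro!: sum.cong simp: mat_mult_index[OF A B] simp del: index_mult_mat(1))
  also have "\<dots> \<le> (\<Sum>i<n. \<Sum>j<p. (\<Sum>k<m. (cmod (A $$ (i, k)))\<^sup>2) * (\<Sum>k<m. (cmod (B $$ (k, j)))\<^sup>2))"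
  proof (intro sum_mono)
    fix i j
    have "cmod (\<Sum>k<m. A $$ (i, k) * B $$ (k, j)) \<le> (\<Sum>k<m. cmod (A $$ (i, k)) * cmod (B $$ (k, j)))"
      using norm_sum[of "\<lambda>k. A $$ (i, k) * B $$ (k, j)" "{..<m}"] by (simp add: norm_mult)
    then have "(cmod (\<Sum>k<m. A $$ (i, k) * B $$ (k, j)))\<^sup>2
        \<le> (\<Sum>k<m. cmod (A $$ (i, k)) * cmod (B $$ (k, j)))\<^sup>2"
      by (intro power_mono) auto
    also have "\<dots> \<le> (\<Sum>k<m. (cmod (A $$ (i, k)))\<^sup>2) * (\<Sum>k<m. (cmod (B $$ (k, j)))\<^sup>2)"
      by (rule Cauchy_Schwarz_ineq_sum)
    finally show "(cmod (\<Sum>k<m. A $$ (i, k) * B $$ (k, j)))\<^sup>2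
        \<le> (\<Sum>k<m. (cmod (A $$ (i, k)))\<^sup>2) * (\<Sum>k<m. (cmod (B $$ (k, j)))\<^sup>2)" .
  qed
  also have "\<dots> = (\<Sum>i<n. \<Sum>k<m. (cmod (A $$ (i, k)))\<^sup>2) * (\<Sum>j<p. \<Sum>k<m. (cmod (B $$ (k, j)))\<^sup>2)"
    by (simp add: sum_product)
  also have "(\<Sum>j<p. \<Sum>k<m. (cmod (B $$ (k, j)))\<^sup>2) = (frob B)\<^sup>2"
    unfolding frob_sq using B by (auto intro: sum.swap)
  also have "(\<Sum>i<n. \<Sum>k<m. (cmod (A $$ (i, k)))\<^sup>2) = (frob A)\<^sup>2"
    unfolding frob_sq using A by auto
  finally show "(frob (A * B))\<^sup>2 \<le> (frob A * frob B)\<^sup>2" by (simp add: power_mult_distrib)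
qed (simp add: frob_nonneg)

lemma frob_inner_mult_left:
  assumes U: "U \<in> carrier_mat n m" and A: "A \<in> carrier_mat m p" and B: "B \<in> carrier_mat n p"
  shows "frob_inner (U * A) B = frob_inner A (mat_adjoint U * B)"
proof -
  note U' = mat_adjoint_carrier[OF U]
  have "frob_inner (U * A) B = (\<Sum>i<n. \<Sum>j<p. \<Sum>k<m. cnj (U $$ (i, k)) * cnj (A $$ (k, j)) * B $$ (i, j))"
    unfolding frob_inner_def using U A
    by (auto intro!: sum.cong simp: mat_mult_index[OF U A] sum_distrib_right simp del: index_mult_mat(1))
  also have "\<dots> = (\<Sum>j<p. \<Sum>i<n. \<Sum>k<m. cnj (U $$ (i, k)) * cnj (A $$ (k, j)) * B $$ (i, j))"
    by (rule sum.swap)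
  also have "\<dots> = (\<Sum>j<p. \<Sum>k<m. \<Sum>i<n. cnj (U $$ (i, k)) * cnj (A $$ (k, j)) * B $$ (i, j))"
    by (rule sum.cong[OF refl], rule sum.swap)
  also have "\<dots> = (\<Sum>k<m. \<Sum>j<p. \<Sum>i<n. cnj (U $$ (i, k)) * cnj (A $$ (k, j)) * B $$ (i, j))"
    by (rule sum.swap)
  also have "\<dots> = frob_inner A (mat_adjoint U * B)"
    unfolding frob_inner_def using U A
    by (auto intro!: sum.cong simp: mat_mult_index[OF U' B] sum_distrib_left mat_adjoint_index mult_ac
        simp del: index_mult_mat(1))
  finally show ?thesis .
qed

lemma frob_inner_mult_right:
  assumes A: "A \<in> carrier_mat n m" and U: "U \<in> carrier_mat m p" and B: "B \<in> carrier_mat n p"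
  shows "frob_inner (A * U) B = frob_inner A (B * mat_adjoint U)"
proof -
  note U' = mat_adjoint_carrier[OF U]
  have "frob_inner (A * U) B = (\<Sum>i<n. \<Sum>j<p. \<Sum>k<m. cnj (A $$ (i, k)) * cnj (U $$ (k, j)) * B $$ (i, j))"
    unfolding frob_inner_def using U A
    by (auto intro!: sum.cong simp: mat_mult_index[OF A U] sum_distrib_right simp del: index_mult_mat(1))
  also have "\<dots> = (\<Sum>i<n. \<Sum>k<m. \<Sum>j<p. cnj (A $$ (i, k)) * cnj (U $$ (k, j)) * B $$ (i, j))"
    by (rule sum.cong[OF refl], rule sum.swap)
  also have "\<dots> = frob_inner A (B * mat_adjoint U)"
    unfolding frob_inner_def using U A
    by (auto intro!: sum.cong simp: mat_mult_index[OF B U'] sum_distrib_left mat_adjoint_index mult_ac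
        simp del: index_mult_mat(1))
  finally show ?thesis .
qed

lemma frob_inner_diff_right:
  assumes "A \<in> carrier_mat n m" "B \<in> carrier_mat n m" "C \<in> carrier_mat n m"
  shows "frob_inner A (B - C) = frob_inner A B - frob_inner A C"
  unfolding frob_inner_def using assms by (simp add: algebra_simps sum_subtractf)

lemma frob_inner_add_right:
  assumes "A \<in> carrier_mat n m" "B \<in> carrier_mat n m" "C \<in> carrier_mat n m"
  shows "frob_inner A (B + C) = frob_inner A B + frob_inner A C"
  unfolding frob_inner_def using assms by (simp add: algebra_simps sum.distrib)

section \<open>Distances, commutators and a covering of the unitary group\<close>

lemma unitary_group_simps [simp]:
  "x \<otimes>\<^bsub>unitary_group n\<^esub> y = x * y" "\<one>\<^bsub>unitary_group n\<^esub> = 1\<^sub>m n"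
  by (simp_all add: unitary_group_def)

lemma unitaryD:
  assumes "x \<in> carrier (unitary_group n)"
  shows "x \<in> carrier_mat n n" "mat_adjoint x \<in> carrier_mat n n"
    "x * mat_adjoint x = 1\<^sub>m n" "mat_adjoint x * x = 1\<^sub>m n"
  using assms mat_adjoint_carrier by (auto simp: unitary_group_def)

lemma adjoint_unitary:
  "x \<in> carrier (unitary_group n) \<Longrightarrow> mat_adjoint x \<in> carrier (unitary_group n)"
  by (auto simp: unitary_group_def mat_adjoint_adjoint intro: mat_adjoint_carrier)

lemma inv_unitary [simp]:
  assumes "x \<in> carrier (unitary_group n)"
  shows "inv\<^bsub>unitary_group n\<^esub> x = mat_adjoint x"
proof -
  interpret group "unitary_group n" by (rule group_unitary_group)
  show ?thesis using assms by (intro inv_equality) (auto simp: adjoint_unitary unitaryD)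
qed

lemma frob_unitary_mult_left:
  assumes x: "x \<in> carrier (unitary_group n)" and B: "B \<in> carrier_mat n m"
  shows "frob (x * B) = frob B"
proof -
  note X = unitaryD[OF x]
  have "frob_inner (x * B) (x * B) = frob_inner B (mat_adjoint x * (x * B))"
    using X B by (intro frob_inner_mult_left[of _ n n _ m]) auto
  also have "mat_adjoint x * (x * B) = B"
    using X B by (simp add: assoc_mult_mat[symmetric, of _ n n _ n _ m])
  finally have "(frob (x * B))\<^sup>2 = (frob B)\<^sup>2" unfolding frob_inner_self of_real_eq_iff .
  then show ?thesis using frob_nonneg by (metis power2_eq_iff_nonneg)
qed

lemma frob_unitary_mult_right:
  assumes x: "x \<in> carrier (unitary_group n)" and B: "B \<in> carrier_mat n n"
  shows "frob (B * x) = frob B"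
proof -
  note X = unitaryD[OF x]
  have "frob_inner (B * x) (B * x) = frob_inner B (B * x * mat_adjoint x)"
    using X B by (intro frob_inner_mult_right) auto
  also have "B * x * mat_adjoint x = B"
    using X B by (simp add: assoc_mult_mat[of _ n n _ n _ n])
  finally have "(frob (B * x))\<^sup>2 = (frob B)\<^sup>2" unfolding frob_inner_self of_real_eq_iff .
  then show ?thesis using frob_nonneg by (metis power2_eq_iff_nonneg)
qed

lemma frob_quotient:
  assumes x: "x \<in> carrier (unitary_group n)" and y: "y \<in> carrier (unitary_group n)"
  shows "frob (mat_adjoint x * y - 1\<^sub>m n) = frob (y - x)"
proof -
  note X = unitaryD[OF x] and Y = unitaryD[OF y]
  have "mat_adjoint x * y - 1\<^sub>m n = mat_adjoint x * (y - x)"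
    using X Y by (simp add: mult_minus_distrib_mat[of _ n n _ n])
  then show ?thesis
    using frob_unitary_mult_left[OF adjoint_unitary[OF x], of "y - x" n] X Y by (simp add: minus_carrier_mat)
qed

lemma frob_quotient_le:
  assumes x: "x \<in> carrier (unitary_group n)" and y: "y \<in> carrier (unitary_group n)"
  shows "frob (mat_adjoint x * y - 1\<^sub>m n) \<le> frob (x - 1\<^sub>m n) + frob (y - 1\<^sub>m n)"
proof -
  note X = unitaryD[OF x] and Y = unitaryD[OF y]
  have "y - x = (y - 1\<^sub>m n) - (x - 1\<^sub>m n)" by (rule eq_matI) (use X Y in auto)
  then show ?thesis
    using frob_diff_le[of "y - 1\<^sub>m n" n n "x - 1\<^sub>m n"] X Y frob_quotient[OF x y]
    by (simp add: minus_carrier_mat)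
qed

text \<open>Right multiplication by unitary matrices preserves the norm, so the left side is the
  norm of \<open>x * y - y * x\<close>. This difference does not change when multiples of the
  identity are subtracted from \<open>x\<close> and \<open>y\<close>, which makes it quadratically
  small.\<close>

lemma frob_commutator_le:
  assumes x: "x \<in> carrier (unitary_group n)" and y: "y \<in> carrier (unitary_group n)"
  shows "frob (x * y * mat_adjoint x * mat_adjoint y - 1\<^sub>m n) \<le> 2 * frob (x - 1\<^sub>m n) * frob (y - 1\<^sub>m n)"
proof -
  note X = unitaryD[OF x] and Y = unitaryD[OF y]
  let ?a = "x - 1\<^sub>m n" and ?b = "y - 1\<^sub>m n"
  have ab: "?a \<in> carrier_mat n n" "?b \<in> carrier_mat n n" "?a * ?b \<in> carrier_mat n n"
    "?b * ?a \<in> carrier_mat n n" using X Y by auto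
  have c: "x * y \<in> carrier_mat n n" "y * x \<in> carrier_mat n n"
    and cx: "(x * y - y * x) * mat_adjoint x \<in> carrier_mat n n"
    using X Y by (auto intro!: mult_carrier_mat minus_carrier_mat)
  have "y * x * mat_adjoint x * mat_adjoint y = y * (x * mat_adjoint x) * mat_adjoint y"
    using X Y by (simp add: assoc_mult_mat[of _ n n _ n _ n])
  then have one: "y * x * mat_adjoint x * mat_adjoint y = 1\<^sub>m n" using X Y by simp
  have "(x * y - y * x) * mat_adjoint x * mat_adjoint y = x * y * mat_adjoint x * mat_adjoint y - 1\<^sub>m n"
    using X Y c one by (simp add: minus_mult_distrib_mat[of _ n n _ _ n])
  then have "frob (x * y * mat_adjoint x * mat_adjoint y - 1\<^sub>m n) = frob (x * y - y * x)"
    using frob_unitary_mult_right[OF adjoint_unitary[OF y], of "(x * y - y * x) * mat_adjoint x"]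
      frob_unitary_mult_right[OF adjoint_unitary[OF x], of "x * y - y * x"] c cx
    by (simp add: minus_carrier_mat)
  also have "x * y - y * x = ?a * ?b - ?b * ?a"
  proof -
    have "?a * ?b = x * ?b - ?b" "x * ?b = x * y - x" "?b * ?a = y * ?a - ?a" "y * ?a = y * x - y"
      using X(1) Y(1) ab(1,2) minus_mult_distrib_mat[of x n n "1\<^sub>m n" ?b n]
        mult_minus_distrib_mat[of x n n y n "1\<^sub>m n"] minus_mult_distrib_mat[of y n n "1\<^sub>m n" ?a n]
        mult_minus_distrib_mat[of y n n x n "1\<^sub>m n"] by simp_all
    then show ?thesis using X(1) Y(1) c
      by (intro eq_matI) (simp_all del: index_mult_mat(1))
  qed
  also have "frob (?a * ?b - ?b * ?a) \<le> frob (?a * ?b) + frob (?b * ?a)" using ab by (intro frob_diff_le) auto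
  also have "\<dots> \<le> frob ?a * frob ?b + frob ?b * frob ?a"
    using ab by (intro add_mono frob_mult_le[of _ n n _ n])
  finally show ?thesis by simp
qed

text \<open>With \<open>P = c - 1\<close>, invariance of the trace under conjugation by \<open>x\<close> gives \<open>\<langle>P, P w\<rangle> = 0\<close>, which for
  \<open>w\<close> close to 1 forces \<open>P = 0\<close>.\<close>

lemma central_commutator_eq_one:
  assumes x: "x \<in> carrier (unitary_group n)" and w: "w \<in> carrier (unitary_group n)"
    and small: "frob (w - 1\<^sub>m n) < 1"
    and c: "c = x * w * mat_adjoint x * mat_adjoint w" and comm: "c * x = x * c"
  shows "c = 1\<^sub>m n"
proof -
  note X = unitaryD[OF x] and W = unitaryD[OF w]
  have cc: "c \<in> carrier_mat n n" unfolding c using X W by auto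
  define P where "P = c - 1\<^sub>m n"
  have P: "P \<in> carrier_mat n n" unfolding P_def using cc by (auto intro: minus_carrier_mat)
  have Px: "P * x = x * P"
    unfolding P_def using cc X comm
    by (simp add: minus_mult_distrib_mat[of _ n n _ _ n] mult_minus_distrib_mat[of _ n n _ n])
  have cw: "c * w = x * w * mat_adjoint x"
    unfolding c using X W by (simp add: assoc_mult_mat[of _ n n _ n _ n])
  have "P * w = x * w * mat_adjoint x - w"
    unfolding P_def using cc W cw by (simp add: minus_mult_distrib_mat[of _ n n _ _ n])
  then have "frob_inner P (P * w) = frob_inner P (x * w * mat_adjoint x) - frob_inner P w"
    using P X W by (simp add: frob_inner_diff_right[of _ n n])
  \<comment> \<open>This and the next two equalities are the invariance of the trace, written with
    adjoints: \<open>x\<close> moves to the other argument, passes through \<open>P\<close>, and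
    cancels.\<close>
  also have "frob_inner P (x * w * mat_adjoint x) = frob_inner (P * x) (x * w)"
    using P X W by (simp add: frob_inner_mult_right[of _ n n _ n])
  also have "\<dots> = frob_inner P (mat_adjoint x * (x * w))"
    unfolding Px using P X W by (simp add: frob_inner_mult_left[of _ n n _ n])
  also have "mat_adjoint x * (x * w) = w"
    using X W by (simp add: assoc_mult_mat[symmetric, of _ n n _ n _ n])
  finally have zero: "frob_inner P (P * w) = 0" by simp
  \<comment> \<open>Replacing \<open>w\<close> by its difference from 1 leaves minus the squared
    norm of \<open>P\<close>. Cauchy-Schwarz bounds this by the same square times a factor less than
    1.\<close>
  have "P * (w - 1\<^sub>m n) = P * w - P"
    using P W by (simp add: mult_minus_distrib_mat[of _ n n _ n])
  then have "frob_inner P (P * (w - 1\<^sub>m n)) = - complex_of_real ((frob P)\<^sup>2)"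
    using zero P W by (simp add: frob_inner_diff_right[of _ n n] frob_inner_self)
  then have "(frob P)\<^sup>2 = cmod (frob_inner P (P * (w - 1\<^sub>m n)))"
    by (simp del: of_real_power)
  also have "\<dots> \<le> frob P * frob (P * (w - 1\<^sub>m n))"
    using P W by (intro frob_inner_le[of _ n n]) (auto intro!: mult_carrier_mat minus_carrier_mat)
  also have "\<dots> \<le> frob P * (frob P * frob (w - 1\<^sub>m n))"
    using P W frob_nonneg by (intro mult_left_mono frob_mult_le[of _ n n _ n]) auto
  finally have "(frob P)\<^sup>2 * (1 - frob (w - 1\<^sub>m n)) \<le> 0"
    by (simp add: power2_eq_square algebra_simps)
  then have "frob P = 0" using small
    by (metis diff_gt_0_iff_gt linorder_not_less mult_pos_pos power2_eq_square zero_le_power2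
        less_eq_real_def power_eq_0_iff)
  then have P0: "P = 0\<^sub>m n n" using frob_eq_0[OF P] by simp
  show ?thesis
  proof (rule eq_matI)
    fix i j assume ij: "i < dim_row (1\<^sub>m n)" "j < dim_col (1\<^sub>m n)"
    then have "P $$ (i, j) = c $$ (i, j) - 1\<^sub>m n $$ (i, j)" unfolding P_def using cc by simp
    then show "c $$ (i, j) = 1\<^sub>m n $$ (i, j)" using P0 ij by simp
  qed (use cc in auto)
qed

lemma unitary_entry_le:
  assumes x: "x \<in> carrier (unitary_group n)" and ij: "i < n" "j < n"
  shows "cmod (x $$ (i, j)) \<le> 1"
proof -
  note X = unitaryD[OF x]
  have "(\<Sum>k<n. x $$ (i, k) * cnj (x $$ (i, k))) = (x * mat_adjoint x) $$ (i, i)"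
    using X ij by (subst mat_mult_index[OF X(1,2)]) (auto simp: mat_adjoint_index intro!: sum.cong)
  then have "complex_of_real (\<Sum>k<n. (cmod (x $$ (i, k)))\<^sup>2) = 1"
    using X ij by (simp add: complex_norm_square del: of_real_power)
  then have "(\<Sum>k<n. (cmod (x $$ (i, k)))\<^sup>2) = 1" using of_real_eq_1_iff by blast
  moreover have "(cmod (x $$ (i, j)))\<^sup>2 \<le> (\<Sum>k<n. (cmod (x $$ (i, k)))\<^sup>2)"
    using ij by (intro member_le_sum) auto
  ultimately show ?thesis by (simp add: abs_square_le_1)
qed

lemma same_floor_diff_le:
  fixes a b :: real
  assumes "0 < s" "\<lfloor>s * a\<rfloor> = \<lfloor>s * b\<rfloor>"
  shows "(a - b)\<^sup>2 \<le> 1 / s\<^sup>2"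
proof -
  have "\<bar>s * a - s * b\<bar> \<le> 1" using assms(2) by linarith
  then have "(s * a - s * b)\<^sup>2 \<le> 1" by (simp add: abs_square_le_1)
  moreover have "(s * a - s * b)\<^sup>2 = s\<^sup>2 * (a - b)\<^sup>2"
    by (simp add: power2_eq_square algebra_simps)
  ultimately show ?thesis using assms(1) by (simp add: field_simps)
qed

text \<open>Pigeonhole on a grid of mesh 1/(8n). The entries have 2n^2 real coordinates in [-1, 1],
  and each floor takes at most 16n + 1 values. In one box the squared distance is at most n^2 times
  2/(8n)^2, that is 1/32, which is below 1/25.\<close>

lemma unitary_cover:
  assumes n: "1 \<le> n" and F: "finite F" "F \<subseteq> carrier (unitary_group n)"
  shows "\<exists>F'\<subseteq>F. real (card F) \<le> real ((16 * n + 1) ^ (2 * n ^ 2)) * card F' \<and>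
    (\<forall>x\<in>F'. \<forall>y\<in>F'. frob (mat_adjoint x * y - 1\<^sub>m n) \<le> 1/5)"
proof -
  define s where "s = 8 * real n"
  have s: "0 < s" unfolding s_def using n by simp
  let ?I = "{..<n} \<times> {..<n}" and ?R = "{- (8 * int n)..8 * int n}"
  define f where "f x = (\<lambda>ij\<in>?I. (\<lfloor>s * Re (x $$ ij)\<rfloor>, \<lfloor>s * Im (x $$ ij)\<rfloor>))" for x :: "complex mat"
  let ?B = "?I \<rightarrow>\<^sub>E ?R \<times> ?R"
  have rng: "\<lfloor>s * t\<rfloor> \<in> ?R" if "\<bar>t\<bar> \<le> 1" for t
  proof -
    have "s * t \<le> s * 1" "s * (-1) \<le> s * t" using that s by (intro mult_left_mono; auto)+
    then show ?thesis unfolding s_def by (auto simp: le_floor_iff floor_le_iff)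
  qed
  have "f \<in> F \<rightarrow> ?B"
  proof (intro Pi_I PiE_I)
    fix x ij assume x: "x \<in> F" and "ij \<in> ?I"
    then obtain i j where ij: "ij = (i, j)" "i < n" "j < n" by auto
    have "cmod (x $$ ij) \<le> 1" unfolding ij(1) using unitary_entry_le F(2) x ij by auto
    then have "\<bar>Re (x $$ ij)\<bar> \<le> 1" "\<bar>Im (x $$ ij)\<bar> \<le> 1"
      using abs_Re_le_cmod[of "x $$ ij"] abs_Im_le_cmod[of "x $$ ij"] by linarith+
    then show "f x ij \<in> ?R \<times> ?R" unfolding f_def using \<open>ij \<in> ?I\<close> rng by simp
  qed (auto simp: f_def)
  moreover have "finite ?B" by (intro finite_PiE) auto
  moreover have "?B \<noteq> {}" by (simp add: PiE_eq_empty_iff)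
  ultimately obtain b where b: "card F \<le> card (f -` {b} \<inter> F) * card ?B"
    using pigeonhole_card[of f F ?B] F(1) by auto
  have "card ?R = 16 * n + 1" by simp
  then have "card (?R \<times> ?R) = (16 * n + 1) ^ 2" by (simp add: card_cartesian_product power2_eq_square)
  then have "card ?B = ((16 * n + 1) ^ 2) ^ (n ^ 2)"
    by (simp only: card_PiE finite_SigmaI finite_lessThan prod_constant card_cartesian_product
        card_lessThan power2_eq_square)
  then have "card ?B = (16 * n + 1) ^ (2 * n ^ 2)" by (simp only: power_mult)
  then have 1: "real (card F) \<le> real ((16 * n + 1) ^ (2 * n ^ 2)) * card (f -` {b} \<inter> F)"
    using b by (metis mult.commute of_nat_le_iff of_nat_mult)
  have "frob (mat_adjoint x * y - 1\<^sub>m n) \<le> 1/5" if "x \<in> f -` {b} \<inter> F" "y \<in> f -` {b} \<inter> F" for x y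
  proof -
    have xy: "x \<in> carrier (unitary_group n)" "y \<in> carrier (unitary_group n)" "f x = f y"
      using that F(2) by auto
    note X = unitaryD[OF xy(1)] and Y = unitaryD[OF xy(2)]
    have entry: "(cmod (y $$ (i, j) - x $$ (i, j)))\<^sup>2 \<le> 2 / s\<^sup>2" if ij: "i < n" "j < n" for i j
    proof -
      have "f x (i, j) = f y (i, j)" using xy(3) by simp
      then have "\<lfloor>s * Re (y $$ (i, j))\<rfloor> = \<lfloor>s * Re (x $$ (i, j))\<rfloor>" "\<lfloor>s * Im (y $$ (i, j))\<rfloor> = \<lfloor>s * Im (x $$ (i, j))\<rfloor>"
        unfolding f_def using ij by auto
      from this[THEN same_floor_diff_le[OF s]] show ?thesis by (simp add: cmod_power2)
    qed
    have "(frob (y - x))\<^sup>2 = (\<Sum>i<n. \<Sum>j<n. (cmod (y $$ (i, j) - x $$ (i, j)))\<^sup>2)"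
      unfolding frob_sq using X Y by auto
    also have "\<dots> \<le> (\<Sum>i<n. \<Sum>j<n. 2 / s\<^sup>2)" using entry by (intro sum_mono) auto
    also have "\<dots> = 1/32" using n unfolding s_def by (simp add: power2_eq_square field_simps)
    also have "\<dots> \<le> (1/5)\<^sup>2" by (simp add: power2_eq_square)
    finally have "frob (y - x) \<le> 1/5" by (rule power2_le_imp_le) simp
    then show ?thesis using frob_quotient[OF xy(1,2)] by simp
  qed
  then show ?thesis using 1 by (intro exI[of _ "f -` {b} \<inter> F"]) auto
qed

section \<open>Commuting chains of unitary matrices\<close>

text \<open>Entrywise with the size as an argument, so that the empty combination also has a
  definite size and the same notion serves square matrices and columns.\<close>

definition lin_comb :: "nat \<Rightarrow> nat \<Rightarrow> (nat \<Rightarrow> complex) \<Rightarrow> (nat \<Rightarrow> complex mat) \<Rightarrow> nat \<Rightarrow> complex mat" where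
  "lin_comb n p c g m = mat n p (\<lambda>ij. \<Sum>l<m. c l * g l $$ ij)"

lemma lin_comb_carrier [simp]: "lin_comb n p c g m \<in> carrier_mat n p"
  by (simp add: lin_comb_def)

lemma lin_comb_dim [simp]: "dim_row (lin_comb n p c g m) = n" "dim_col (lin_comb n p c g m) = p"
  by (simp_all add: lin_comb_def)

lemma lin_comb_index: "i < n \<Longrightarrow> j < p \<Longrightarrow> lin_comb n p c g m $$ (i, j) = (\<Sum>l<m. c l * g l $$ (i, j))"
  by (simp add: lin_comb_def)

lemma lin_comb_cong:
  assumes "\<And>l. l < m \<Longrightarrow> g l = h l"
  shows "lin_comb n p c g m = lin_comb n p c h m"
  unfolding lin_comb_def using assms by auto

lemma lin_comb_mult_right:
  assumes g: "\<And>l. l < m \<Longrightarrow> g l \<in> carrier_mat n p" and B: "B \<in> carrier_mat p q"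
  shows "lin_comb n p c g m * B = lin_comb n q c (\<lambda>l. g l * B) m"
proof (rule eq_matI)
  fix i j assume ij: "i < dim_row (lin_comb n q c (\<lambda>l. g l * B) m)" "j < dim_col (lin_comb n q c (\<lambda>l. g l * B) m)"
  then have "(lin_comb n p c g m * B) $$ (i, j) = (\<Sum>k<p. \<Sum>l<m. c l * g l $$ (i, k) * B $$ (k, j))"
    using B by (subst mat_mult_index[of _ n p _ q]) (auto simp: lin_comb_index sum_distrib_right)
  also have "\<dots> = (\<Sum>l<m. \<Sum>k<p. c l * g l $$ (i, k) * B $$ (k, j))" by (rule sum.swap)
  also have "\<dots> = (\<Sum>l<m. c l * (g l * B) $$ (i, j))"
    using ij by (intro sum.cong refl) (simp add: mat_mult_index[OF g B] sum_distrib_left mult_ac del: index_mult_mat(1))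
  finally show "(lin_comb n p c g m * B) $$ (i, j) = lin_comb n q c (\<lambda>l. g l * B) m $$ (i, j)"
    using ij by (simp add: lin_comb_index)
qed (use B in auto)

lemma lin_comb_mult_left:
  assumes g: "\<And>l. l < m \<Longrightarrow> g l \<in> carrier_mat p q" and B: "B \<in> carrier_mat n p"
  shows "B * lin_comb p q c g m = lin_comb n q c (\<lambda>l. B * g l) m"
proof (rule eq_matI)
  fix i j assume ij: "i < dim_row (lin_comb n q c (\<lambda>l. B * g l) m)" "j < dim_col (lin_comb n q c (\<lambda>l. B * g l) m)"
  then have "(B * lin_comb p q c g m) $$ (i, j) = (\<Sum>k<p. \<Sum>l<m. B $$ (i, k) * (c l * g l $$ (k, j)))"
    using B by (subst mat_mult_index[of _ n p _ q]) (auto simp: lin_comb_index sum_distrib_left)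
  also have "\<dots> = (\<Sum>l<m. \<Sum>k<p. B $$ (i, k) * (c l * g l $$ (k, j)))" by (rule sum.swap)
  also have "\<dots> = (\<Sum>l<m. c l * (B * g l) $$ (i, j))"
    using ij by (intro sum.cong refl) (simp add: mat_mult_index[OF B g] sum_distrib_left mult_ac del: index_mult_mat(1))
  finally show "(B * lin_comb p q c g m) $$ (i, j) = lin_comb n q c (\<lambda>l. B * g l) m $$ (i, j)"
    using ij by (simp add: lin_comb_index)
qed (use B in auto)

lemma lin_comb_commute:
  assumes g: "\<And>l. l < m \<Longrightarrow> g l \<in> carrier_mat n n" and B: "B \<in> carrier_mat n n"
    and "\<And>l. l < m \<Longrightarrow> g l * B = B * g l"
  shows "lin_comb n n c g m * B = B * lin_comb n n c g m"
proof -
  have "lin_comb n n c (\<lambda>l. g l * B) m = lin_comb n n c (\<lambda>l. B * g l) m"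
    using assms(3) by (rule lin_comb_cong)
  then show ?thesis by (simp add: lin_comb_mult_right[OF g B] lin_comb_mult_left[OF g B])
qed

lemma commute_adjoint_unitary:
  assumes u: "u \<in> carrier (unitary_group n)" and B: "B \<in> carrier_mat n n" and c: "u * B = B * u"
  shows "mat_adjoint u * B = B * mat_adjoint u"
proof -
  note U = unitaryD[OF u]
  have "mat_adjoint u * B = mat_adjoint u * (B * u) * mat_adjoint u"
    using U B by (simp add: assoc_mult_mat[of _ n n _ n _ n])
  also have "\<dots> = mat_adjoint u * (u * B) * mat_adjoint u" using c by simp
  also have "\<dots> = B * mat_adjoint u"
    using U B by (simp add: assoc_mult_mat[symmetric, of _ n n _ n _ n])
  finally show ?thesis .
qed

lemma adjoint_lin_comb:
  assumes "\<And>l. l < m \<Longrightarrow> g l \<in> carrier_mat n n"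
  shows "mat_adjoint (lin_comb n n c g m) = lin_comb n n (\<lambda>l. cnj (c l)) (\<lambda>l. mat_adjoint (g l)) m"
proof (rule eq_matI)
  note car = mat_adjoint_carrier[OF lin_comb_carrier[of n n c g m]]
  fix i j assume "i < dim_row (lin_comb n n (\<lambda>l. cnj (c l)) (\<lambda>l. mat_adjoint (g l)) m)"
    "j < dim_col (lin_comb n n (\<lambda>l. cnj (c l)) (\<lambda>l. mat_adjoint (g l)) m)"
  then have ij: "i < n" "j < n" by auto
  have "cnj (g l $$ (j, i)) = mat_adjoint (g l) $$ (i, j)" if "l < m" for l
    using assms[OF that] ij by (simp add: mat_adjoint_index)
  then show "mat_adjoint (lin_comb n n c g m) $$ (i, j)
      = lin_comb n n (\<lambda>l. cnj (c l)) (\<lambda>l. mat_adjoint (g l)) m $$ (i, j)"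
    using ij by (simp add: mat_adjoint_index lin_comb_index)
qed (use mat_adjoint_carrier[OF lin_comb_carrier[of n n c g m]] in auto)

text \<open>The diagonal entries of the product are the squared norms of the rows of
  \<open>x\<close>.\<close>

lemma mult_adjoint_eq_0:
  fixes x :: "complex mat"
  assumes x: "x \<in> carrier_mat n m" and e: "x * mat_adjoint x = 0\<^sub>m n n"
  shows "x = 0\<^sub>m n m"
proof (rule eq_matI)
  fix i j assume "i < dim_row (0\<^sub>m n m)" "j < dim_col (0\<^sub>m n m)"
  then have ij: "i < n" "j < m" by auto
  have "(\<Sum>k<m. x $$ (i, k) * cnj (x $$ (i, k))) = (x * mat_adjoint x) $$ (i, i)"
    using x mat_adjoint_carrier[OF x] ij
    by (subst mat_mult_index[of _ n m _ n]) (auto simp: mat_adjoint_index intro!: sum.cong)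
  then have "complex_of_real (\<Sum>k<m. (cmod (x $$ (i, k)))\<^sup>2) = 0"
    using e ij by (simp add: complex_norm_square del: of_real_power)
  then have "(\<Sum>k<m. (cmod (x $$ (i, k)))\<^sup>2) = 0" using of_real_eq_0_iff by blast
  then have "(cmod (x $$ (i, j)))\<^sup>2 = 0" using ij by (subst (asm) sum_nonneg_eq_0_iff) auto
  then show "x $$ (i, j) = 0\<^sub>m n m $$ (i, j)" using ij by simp
qed (use x in auto)

lemma frob_inner_zero_right:
  "A \<in> carrier_mat n m \<Longrightarrow> frob_inner A (0\<^sub>m n m) = 0"
  by (simp add: frob_inner_def)

lemma column_independent_imp_le:
  assumes g: "\<And>l. l < k \<Longrightarrow> g l \<in> carrier_mat n n" and v: "v \<in> carrier_mat n 1"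
    and indep: "\<And>c. lin_comb n n c g k * v = 0\<^sub>m n 1 \<Longrightarrow> \<forall>l<k. c l = 0"
  shows "k \<le> n"
proof (rule ccontr)
  assume "\<not> k \<le> n"
  then have nk: "Suc n \<le> k" by simp
  \<comment> \<open>The columns \<open>g l * v\<close> for the first \<open>n + 1\<close> indices,
    with a zero row added to make the matrix square. Its determinant vanishes, and a kernel vector
    gives a nontrivial relation.\<close>
  define M where "M = mat (Suc n) (Suc n) (\<lambda>(a, l). if a < n then (g l * v) $$ (a, 0) else 0)"
  have M: "M \<in> carrier_mat (Suc n) (Suc n)" unfolding M_def by simp
  have "transpose_mat M *\<^sub>v unit_vec (Suc n) n = 0\<^sub>v (Suc n)"
    using M by (intro eq_vecI) (auto simp: M_def)
  then have "det (transpose_mat M) = 0"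
    using det_0_iff_vec_prod_zero[of "transpose_mat M" "Suc n"] M
    by (auto intro!: exI[of _ "unit_vec (Suc n) n"])
  then have "det M = 0" using det_transpose[OF M] by simp
  then obtain w where w: "w \<in> carrier_vec (Suc n)" "w \<noteq> 0\<^sub>v (Suc n)" "M *\<^sub>v w = 0\<^sub>v (Suc n)"
    using det_0_iff_vec_prod_zero[OF M] by auto
  define c where "c l = (if l < Suc n then w $ l else 0)" for l
  have "lin_comb n n c g k * v = 0\<^sub>m n 1"
  proof (rule eq_matI)
    fix i j assume "i < dim_row (0\<^sub>m n 1 :: complex mat)" "j < dim_col (0\<^sub>m n 1 :: complex mat)"
    then have ij: "i < n" "j = 0" by auto
    have "(lin_comb n n c g k * v) $$ (i, j) = (\<Sum>l<k. c l * (g l * v) $$ (i, 0))"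
      using ij by (simp add: lin_comb_mult_right[OF g v] lin_comb_index del: index_mult_mat(1))
    also have "\<dots> = (\<Sum>l<Suc n. c l * (g l * v) $$ (i, 0))"
      using nk by (intro sum.mono_neutral_right) (auto simp: c_def)
    also have "\<dots> = (M *\<^sub>v w) $ i"
      using ij w(1) M
      by (auto simp: c_def M_def scalar_prod_def lessThan_atLeast0 mult.commute intro!: sum.cong
          simp del: index_mult_mat(1) sum.lessThan_Suc sum.op_ivl_Suc)
    finally show "(lin_comb n n c g k * v) $$ (i, j) = 0\<^sub>m n 1 $$ (i, j)" using w(3) ij by simp
  qed (use v in auto)
  then have "\<forall>l<k. c l = 0" by (rule indep)
  then have "w $ l = 0" if "l < Suc n" for l using that nk unfolding c_def by (metis order_less_le_trans)
  then have "w = 0\<^sub>v (Suc n)" using w(1) by (intro eq_vecI) auto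
  then show False using w(2) by simp
qed

text \<open>A vector \<open>v\<close> on which \<open>g 0, \<dots>, g (m - 1)\<close> are independent, but \<open>x v = 0\<close> for a nonzero
  combination \<open>x\<close> of \<open>g 0, \<dots>, g m\<close>, is corrected to \<open>v + x\<^sup>* e\<close> with \<open>x x\<^sup>* e \<noteq> 0\<close>: the kernel of \<open>x\<close>
  and the range of \<open>x\<^sup>*\<close> are orthogonal and invariant under everything that commutes with \<open>x\<close> and
  \<open>x\<^sup>*\<close>.\<close>

lemma separating_vector:
  assumes ch: "commuting_chain (unitary_group n) g y k" and "m \<le> k"
  shows "\<exists>v\<in>carrier_mat n 1. \<forall>c. lin_comb n n c g m * v = 0\<^sub>m n 1 \<longrightarrow> (\<forall>l<m. c l = 0)"
  using \<open>m \<le> k\<close>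
proof (induction m)
  case 0
  show ?case by (intro bexI[of _ "0\<^sub>m n 1"]) auto
next
  case (Suc m)
  then obtain v where v: "v \<in> carrier_mat n 1"
    and ind: "\<And>c. lin_comb n n c g m * v = 0\<^sub>m n 1 \<Longrightarrow> \<forall>l<m. c l = 0" by auto
  have gU: "g l \<in> carrier (unitary_group n)" if "l < Suc m" for l
    using ch that Suc.prems by (auto simp: commuting_chain_def)
  have g: "g l \<in> carrier_mat n n" if "l < Suc m" for l using unitaryD(1)[OF gU[OF that]] .
  have gm: "g l \<in> carrier_mat n n" if "l < m" for l using g that by simp
  have gg: "g l * g l' = g l' * g l" if "l < Suc m" "l' < Suc m" for l l'
    using ch that Suc.prems by (auto simp: commuting_chain_def)
  have split: "lin_comb n n c g (Suc m) * B = lin_comb n p c (\<lambda>l. g l * B) (Suc m)"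
    if "B \<in> carrier_mat n p" for B c p using that by (intro lin_comb_mult_right g)
  show ?case
  proof (cases "\<forall>c. lin_comb n n c g (Suc m) * v = 0\<^sub>m n 1 \<longrightarrow> (\<forall>l<Suc m. c l = 0)")
    case True
    then show ?thesis using v by blast
  next
    case False
    then obtain c where c: "lin_comb n n c g (Suc m) * v = 0\<^sub>m n 1" "\<exists>l<Suc m. c l \<noteq> 0" by blast
    have cm: "c m \<noteq> 0"
    proof
      assume "c m = 0"
      then have "lin_comb n n c g (Suc m) = lin_comb n n c g m" unfolding lin_comb_def by auto
      then have "\<forall>l<m. c l = 0" using ind c(1) by simp
      then show False using c(2) \<open>c m = 0\<close> less_Suc_eq by auto
    qed
    define x where "x = lin_comb n n c g (Suc m)"
    have x: "x \<in> carrier_mat n n" unfolding x_def by simp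
    note x' = mat_adjoint_carrier[OF x]
    have x_g: "x * g l = g l * x" if "l < Suc m" for l
      unfolding x_def using g gg that by (intro lin_comb_commute) auto
    have adj: "mat_adjoint x = lin_comb n n (\<lambda>l. cnj (c l)) (\<lambda>l. mat_adjoint (g l)) (Suc m)"
      unfolding x_def by (rule adjoint_lin_comb[OF g])
    have x'_g: "mat_adjoint x * g l = g l * mat_adjoint x" if "l < Suc m" for l
      unfolding adj
      using mat_adjoint_carrier[OF g] that g commute_adjoint_unitary[OF gU _ gg]
      by (intro lin_comb_commute) auto
    \<comment> \<open>The witness \<open>y m\<close> is used here: it commutes with all terms of
      \<open>x\<close> except the last, and the last coefficient \<open>c m\<close> is not 0, so
      \<open>x\<close> cannot commute with \<open>y m\<close> as the zero matrix would.\<close>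
    have "x \<noteq> 0\<^sub>m n n"
    proof
      assume x0: "x = 0\<^sub>m n n"
      have ym: "y m \<in> carrier_mat n n" "g m * y m \<noteq> y m * g m"
        using ch Suc.prems unitaryD(1) by (auto simp: commuting_chain_def)
      have yg: "g l * y m = y m * g l" if "l < m" for l
        using ch Suc.prems that by (auto simp: commuting_chain_def)
      have "lin_comb n n c (\<lambda>l. g l * y m) (Suc m) = lin_comb n n c (\<lambda>l. y m * g l) (Suc m)"
      proof -
        have "lin_comb n n c (\<lambda>l. g l * y m) (Suc m) = x * y m"
          unfolding x_def by (rule lin_comb_mult_right[OF g ym(1), symmetric])
        also have "\<dots> = y m * x" using x0 ym(1) by simp
        also have "\<dots> = lin_comb n n c (\<lambda>l. y m * g l) (Suc m)"
          unfolding x_def by (rule lin_comb_mult_left[OF g ym(1)])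
        finally show ?thesis .
      qed
      then have eq: "lin_comb n n c (\<lambda>l. g l * y m) (Suc m) $$ (i, j)
          = lin_comb n n c (\<lambda>l. y m * g l) (Suc m) $$ (i, j)" for i j by simp
      have "g m * y m = y m * g m"
      proof (rule eq_matI)
        fix i j assume "i < dim_row (y m * g m)" "j < dim_col (y m * g m)"
        then have ij: "i < n" "j < n" using ym(1) g[of m] by auto
        have "(\<Sum>l<m. c l * (g l * y m) $$ (i, j)) = (\<Sum>l<m. c l * (y m * g l) $$ (i, j))"
          using yg by (intro sum.cong) auto
        then have "c m * (g m * y m) $$ (i, j) = c m * (y m * g m) $$ (i, j)"
          using eq[of i j] ij by (simp add: lin_comb_index del: index_mult_mat(1))
        then show "(g m * y m) $$ (i, j) = (y m * g m) $$ (i, j)"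
          using cm by (simp del: index_mult_mat(1))
      qed (use ym(1) g[of m] in auto)
      then show False using ym(2) by simp
    qed
    then have "x * mat_adjoint x \<noteq> 0\<^sub>m n n" using mult_adjoint_eq_0[OF x] by blast
    then obtain a b where ab: "a < n" "b < n" "(x * mat_adjoint x) $$ (a, b) \<noteq> 0"
    proof -
      have "\<exists>a<n. \<exists>b<n. (x * mat_adjoint x) $$ (a, b) \<noteq> 0"
      proof (rule ccontr)
        assume "\<not> ?thesis"
        then have "x * mat_adjoint x = 0\<^sub>m n n"
          using x x' by (intro eq_matI) (auto simp del: index_mult_mat(1))
        then show False using \<open>x * mat_adjoint x \<noteq> 0\<^sub>m n n\<close> by simp
      qed
      then show ?thesis using that by blast
    qed
    \<comment> \<open>The unit column that picks out column \<open>b\<close> of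
      \<open>x * mat_adjoint x\<close>, where a nonzero entry was found.\<close>
    define e where "e = mat n 1 (\<lambda>(i, j). if i = b then 1 else 0 :: complex)"
    have e: "e \<in> carrier_mat n 1" unfolding e_def by simp
    define w where "w = mat_adjoint x * e"
    have w: "w \<in> carrier_mat n 1" unfolding w_def using x' e by simp
    have xw: "x * w \<noteq> 0\<^sub>m n 1"
    proof
      assume 0: "x * w = 0\<^sub>m n 1"
      have xx: "x * mat_adjoint x \<in> carrier_mat n n" using x x' by simp
      have "x * w = (x * mat_adjoint x) * e"
        unfolding w_def using x x' e by (simp add: assoc_mult_mat[of _ n n _ n _ 1])
      then have "(x * w) $$ (a, 0) = (\<Sum>k<n. (x * mat_adjoint x) $$ (a, k) * e $$ (k, 0))"
        using mat_mult_index[OF xx e, of a 0] ab by simp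
      also have "\<dots> = (\<Sum>k<n. if k = b then (x * mat_adjoint x) $$ (a, k) else 0)"
        unfolding e_def by (intro sum.cong) (auto simp del: index_mult_mat(1))
      also have "\<dots> = (x * mat_adjoint x) $$ (a, b)" using ab by (simp del: index_mult_mat(1))
      finally show False using 0 ab by simp
    qed
    show ?thesis
    proof (intro bexI[of _ "v + w"] allI impI)
      fix c' l assume 0: "lin_comb n n c' g (Suc m) * (v + w) = 0\<^sub>m n 1" and l: "l < Suc m"
      define z where "z = lin_comb n n c' g (Suc m)"
      have z: "z \<in> carrier_mat n n" unfolding z_def by simp
      have zx: "z * x = x * z"
        unfolding z_def using g x x_g by (intro lin_comb_commute) auto
      have zx': "z * mat_adjoint x = mat_adjoint x * z"
        unfolding z_def using g x' x'_g by (intro lin_comb_commute) auto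
      have zv: "z * v \<in> carrier_mat n 1" and zw: "z * w \<in> carrier_mat n 1" using z v w by auto
      have sum0: "z * v + z * w = 0\<^sub>m n 1"
        using 0 v w z unfolding z_def[symmetric] by (simp add: mult_add_distrib_mat[of _ n n _ 1])
      \<comment> \<open>Because \<open>z\<close> commutes with \<open>x\<close> and its adjoint,
        \<open>z * v\<close> stays in the kernel of \<open>x\<close> and \<open>z * w\<close> in the
        range of the adjoint. Being orthogonal with sum 0, both vanish.\<close>
      have "x * (z * v) = z * (x * v)"
        using assoc_mult_mat[OF x z v] assoc_mult_mat[OF z x v] zx by metis
      also have "\<dots> = 0\<^sub>m n 1" using c(1) z unfolding x_def by simp
      finally have xzv: "x * (z * v) = 0\<^sub>m n 1" .
      have "z * w = mat_adjoint x * (z * e)"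
        unfolding w_def using assoc_mult_mat[OF x' z e] assoc_mult_mat[OF z x' e] zx' by metis
      then have "frob_inner (z * w) (z * v) = frob_inner (z * e) (mat_adjoint (mat_adjoint x) * (z * v))"
        using x' z e zv by (simp add: frob_inner_mult_left[of _ n n _ 1])
      also have "\<dots> = 0"
        using mat_adjoint_adjoint[OF x] xzv frob_inner_zero_right[of "z * e" n 1] z e by simp
      finally have orth: "frob_inner (z * w) (z * v) = 0" .
      have "frob_inner (z * w) (z * v + z * w) = frob_inner (z * w) (z * v) + frob_inner (z * w) (z * w)"
        using zv zw by (intro frob_inner_add_right[of _ n 1])
      then have "frob_inner (z * w) (z * w) = 0"
        using orth sum0 frob_inner_zero_right[OF zw] by simp
      then have "frob (z * w) = 0" unfolding frob_inner_self by simp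
      then have zw0: "z * w = 0\<^sub>m n 1" using frob_eq_0[OF zw] by simp
      then have zv0: "z * v = 0\<^sub>m n 1" using sum0 zv by simp
      \<comment> \<open>Subtracting \<open>r\<close> times the relation \<open>x\<close> from
        \<open>z\<close> removes the last coefficient, so that independence of the first
        \<open>m\<close> matrices on \<open>v\<close> applies.\<close>
      define r where "r = c' m / c m"
      define c'' where "c'' i = c' i - r * c i" for i
      have c''m: "c'' m = 0" unfolding c''_def r_def using cm by simp
      have c''_eq: "lin_comb n 1 c'' (\<lambda>l. g l * B) m $$ (i, 0) = (z * B) $$ (i, 0) - r * (x * B) $$ (i, 0)"
        if "i < n" "B \<in> carrier_mat n 1" for i B
      proof -
        have "lin_comb n 1 c'' (\<lambda>l. g l * B) m $$ (i, 0) = (\<Sum>l<Suc m. c'' l * (g l * B) $$ (i, 0))"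
          using that c''m by (simp add: lin_comb_index del: index_mult_mat(1))
        also have "\<dots> = (\<Sum>l<Suc m. c' l * (g l * B) $$ (i, 0)) - r * (\<Sum>l<Suc m. c l * (g l * B) $$ (i, 0))"
          unfolding c''_def by (simp add: algebra_simps sum_subtractf sum_distrib_left
              del: index_mult_mat(1) sum.lessThan_Suc)
        also have "\<dots> = (z * B) $$ (i, 0) - r * (x * B) $$ (i, 0)"
          unfolding z_def x_def split[OF that(2)] using that
          by (simp add: lin_comb_index del: index_mult_mat(1) sum.lessThan_Suc)
        finally show ?thesis .
      qed
      have conv: "lin_comb n n c'' g m * v = lin_comb n 1 c'' (\<lambda>l. g l * v) m"
        by (rule lin_comb_mult_right[OF gm v])
      have "lin_comb n n c'' g m * v = 0\<^sub>m n 1"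
      proof (rule eq_matI)
        fix i j assume "i < dim_row (0\<^sub>m n 1 :: complex mat)" "j < dim_col (0\<^sub>m n 1 :: complex mat)"
        then have ij: "i < n" "j = 0" by auto
        have "(lin_comb n n c'' g m * v) $$ (i, j) = (z * v) $$ (i, 0) - r * (x * v) $$ (i, 0)"
          using c''_eq[OF ij(1) v] unfolding ij(2) conv .
        also have "\<dots> = 0" using zv0 c(1) ij unfolding x_def by simp
        finally show "(lin_comb n n c'' g m * v) $$ (i, j) = 0\<^sub>m n 1 $$ (i, j)" using ij by simp
      qed (use v in auto)
      then have c''0: "\<forall>l<m. c'' l = 0" by (rule ind)
      \<comment> \<open>By now \<open>z\<close> is \<open>r\<close> times \<open>x\<close>. Since
        \<open>z\<close> kills \<open>w\<close> and \<open>x\<close> does not, the factor is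
        0.\<close>
      have "r = 0"
      proof (rule ccontr)
        assume r: "r \<noteq> 0"
        have "x * w = 0\<^sub>m n 1"
        proof (rule eq_matI)
          fix i j assume "i < dim_row (0\<^sub>m n 1 :: complex mat)" "j < dim_col (0\<^sub>m n 1 :: complex mat)"
          then have ij: "i < n" "j = 0" by auto
          have "lin_comb n 1 c'' (\<lambda>l. g l * w) m $$ (i, 0) = 0"
            using c''0 ij by (simp add: lin_comb_index del: index_mult_mat(1))
          then have "r * (x * w) $$ (i, 0) = 0"
            using c''_eq[OF ij(1) w] zw0 ij by simp
          then show "(x * w) $$ (i, j) = 0\<^sub>m n 1 $$ (i, j)"
            using r ij by (simp del: index_mult_mat(1))
        qed (use x w in auto)
        then show False using xw by simp
      qed
      then show "c' l = 0" using c''0 c''m l unfolding c''_def by (auto simp: less_Suc_eq)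
    qed (use v w in auto)
  qed
qed

text \<open>Applying the chain to a separating vector gives \<open>k\<close> independent columns
  with \<open>n\<close> entries.\<close>

lemma commuting_chain_unitary_le:
  assumes ch: "commuting_chain (unitary_group n) g y k"
  shows "k \<le> n"
proof -
  obtain v where v: "v \<in> carrier_mat n 1" "\<And>c. lin_comb n n c g k * v = 0\<^sub>m n 1 \<Longrightarrow> \<forall>l<k. c l = 0"
    using separating_vector[OF ch order_refl] by blast
  show ?thesis
    by (rule column_independent_imp_le[OF _ v])
      (use ch unitaryD(1) in \<open>auto simp: commuting_chain_def\<close>)
qed

section \<open>Connectedness of commutants\<close>

lemma continuous_on_det:
  fixes M :: "real \<Rightarrow> complex mat"
  assumes M: "\<And>t. t \<in> T \<Longrightarrow> M t \<in> carrier_mat n n"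
    and cont: "\<And>i j. i < n \<Longrightarrow> j < n \<Longrightarrow> continuous_on T (\<lambda>t. M t $$ (i, j))"
  shows "continuous_on T (\<lambda>t. det (M t))"
proof -
  have "continuous_on T (\<lambda>t. \<Sum>p\<in>{p. p permutes {0..<n}}. signof p * (\<Prod>i = 0..<n. M t $$ (i, p i)))"
  proof (intro continuous_on_sum continuous_on_mult continuous_on_const continuous_on_prod)
    fix p i assume "p \<in> {p. p permutes {0..<n}}" "i \<in> {0..<n}"
    then have "p i < n" using permutes_in_image[of p "{0..<n}" i] by auto
    then show "continuous_on T (\<lambda>t. M t $$ (i, p i))" using \<open>i \<in> {0..<n}\<close> by (intro cont) auto
  qed
  then show ?thesis by (rule continuous_on_eq) (simp add: det_def'[OF M])
qed

text \<open>Its entries are signed minors, hence polynomial in the entries of the matrix. Together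
  with the determinant this makes the inverse depend continuously on a parameter.\<close>

lemma continuous_on_adj_mat:
  fixes M :: "real \<Rightarrow> complex mat"
  assumes M: "\<And>t. t \<in> T \<Longrightarrow> M t \<in> carrier_mat n n"
    and cont: "\<And>i j. i < n \<Longrightarrow> j < n \<Longrightarrow> continuous_on T (\<lambda>t. M t $$ (i, j))"
    and ij: "i < n" "j < n"
  shows "continuous_on T (\<lambda>t. adj_mat (M t) $$ (i, j))"
proof -
  have del: "mat_delete (M t) j i \<in> carrier_mat (n - 1) (n - 1)" if "t \<in> T" for t
    using M[OF that] by (auto simp: mat_delete_def)
  have "continuous_on T (\<lambda>t. mat_delete (M t) j i $$ (i', j'))" if "i' < n - 1" "j' < n - 1" for i' j'
  proof -
    let ?a = "if i' < j then i' else Suc i'" and ?b = "if j' < i then j' else Suc j'"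
    have "mat_delete (M t) j i $$ (i', j') = M t $$ (?a, ?b)" if "t \<in> T" for t
      using M[OF that] \<open>i' < n - 1\<close> \<open>j' < n - 1\<close> by (auto simp: mat_delete_def)
    moreover have "continuous_on T (\<lambda>t. M t $$ (?a, ?b))" using that by (intro cont) auto
    ultimately show ?thesis by (simp cong: continuous_on_cong)
  qed
  then have "continuous_on T (\<lambda>t. (-1) ^ (j + i) * det (mat_delete (M t) j i))"
    by (intro continuous_intros continuous_on_det[OF del])
  moreover have "adj_mat (M t) $$ (i, j) = (-1) ^ (j + i) * det (mat_delete (M t) j i)" if "t \<in> T" for t
    using M[OF that] ij by (simp add: adj_mat_def cofactor_def)
  ultimately show ?thesis by (simp cong: continuous_on_cong)
qed

lemma continuous_on_mat_mult:
  fixes M L :: "real \<Rightarrow> complex mat"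
  assumes M: "\<And>t. t \<in> T \<Longrightarrow> M t \<in> carrier_mat n n" and L: "\<And>t. t \<in> T \<Longrightarrow> L t \<in> carrier_mat n n"
    and "\<And>i j. i < n \<Longrightarrow> j < n \<Longrightarrow> continuous_on T (\<lambda>t. M t $$ (i, j))"
    and "\<And>i j. i < n \<Longrightarrow> j < n \<Longrightarrow> continuous_on T (\<lambda>t. L t $$ (i, j))"
    and ij: "i < n" "j < n"
  shows "continuous_on T (\<lambda>t. (M t * L t) $$ (i, j))"
proof -
  have "continuous_on T (\<lambda>t. \<Sum>k<n. M t $$ (i, k) * L t $$ (k, j))"
    using assms by (intro continuous_intros) auto
  then show ?thesis
    using mat_mult_index[OF M L ij] by (simp cong: continuous_on_cong del: index_mult_mat(1))
qed

lemma unitary_eigenvalue_norm: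
  assumes u: "u \<in> carrier (unitary_group n)" and k: "eigenvalue u k"
  shows "cmod k = 1"
proof -
  note U = unitaryD[OF u]
  obtain v where v: "v \<in> carrier_vec n" "v \<noteq> 0\<^sub>v n" "u *\<^sub>v v = k \<cdot>\<^sub>v v"
    using k U by (auto simp: eigenvalue_def eigenvector_def)
  \<comment> \<open>The eigenvector as a matrix of width 1, so that invariance of
    \<open>frob\<close> under unitary multiplication applies to it.\<close>
  define V where "V = mat n 1 (\<lambda>(i, j). v $ i)"
  have V: "V \<in> carrier_mat n 1" unfolding V_def by simp
  have "u * V = k \<cdot>\<^sub>m V"
  proof (rule eq_matI)
    fix i j assume "i < dim_row (k \<cdot>\<^sub>m V)" "j < dim_col (k \<cdot>\<^sub>m V)"
    then have ij: "i < n" "j = 0" using V by auto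
    have "(u * V) $$ (i, 0) = (u *\<^sub>v v) $ i"
      using ij U V v(1) unfolding V_def by (auto simp: scalar_prod_def)
    then show "(u * V) $$ (i, j) = (k \<cdot>\<^sub>m V) $$ (i, j)"
      using ij v(1,3) unfolding V_def by simp
  qed (use U V in auto)
  then have eq: "frob (k \<cdot>\<^sub>m V) = frob V" using frob_unitary_mult_left[OF u V] by simp
  have "(frob (k \<cdot>\<^sub>m V))\<^sup>2 = (cmod k)\<^sup>2 * (frob V)\<^sup>2"
    unfolding frob_sq using V by (simp add: norm_mult power_mult_distrib sum_distrib_left)
  then have "(frob V)\<^sup>2 = (cmod k)\<^sup>2 * (frob V)\<^sup>2" using eq by simp
  moreover have "frob V \<noteq> 0"
  proof
    assume "frob V = 0"
    then have V0: "V = 0\<^sub>m n 1" using frob_eq_0[OF V] by simp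
    have "v $ i = 0" if "i < n" for i
    proof -
      have "V $$ (i, 0) = 0" using V0 that by simp
      then show ?thesis using that unfolding V_def by simp
    qed
    then have "v = 0\<^sub>v n" using v(1) by (intro eq_vecI) auto
    then show False using v(2) by simp
  qed
  ultimately have "(cmod k)\<^sup>2 = 1" by simp
  then show ?thesis using power2_eq_iff_nonneg[of "cmod k" 1] by simp
qed

lemma det_scalar_plus_nonzero:
  fixes u :: "complex mat"
  assumes u: "u \<in> carrier_mat n n" and ev: "\<beta> \<noteq> 0 \<Longrightarrow> \<not> eigenvalue u (- \<alpha> / \<beta>)" and \<alpha>: "\<alpha> \<noteq> 0"
  shows "det (\<alpha> \<cdot>\<^sub>m 1\<^sub>m n + \<beta> \<cdot>\<^sub>m u) \<noteq> 0"
proof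
  let ?p = "\<alpha> \<cdot>\<^sub>m 1\<^sub>m n + \<beta> \<cdot>\<^sub>m u"
  assume "det ?p = 0"
  moreover have "?p \<in> carrier_mat n n" using u by auto
  ultimately obtain v where v: "v \<in> carrier_vec n" "v \<noteq> 0\<^sub>v n" "?p *\<^sub>v v = 0\<^sub>v n"
    using det_0_iff_vec_prod_zero by blast
  have eq: "\<alpha> * v $ i + \<beta> * (u *\<^sub>v v) $ i = 0" if "i < n" for i
  proof -
    have "(?p *\<^sub>v v) $ i = (\<Sum>k<n. (\<alpha> * (if i = k then 1 else 0) + \<beta> * u $$ (i, k)) * v $ k)"
      using that u v(1) by (auto simp: scalar_prod_def lessThan_atLeast0 intro!: sum.cong)
    also have "\<dots> = (\<Sum>k<n. if k = i then \<alpha> * v $ k else 0) + \<beta> * (\<Sum>k<n. u $$ (i, k) * v $ k)"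
      by (simp add: algebra_simps sum.distrib sum_distrib_left if_distrib[of "\<lambda>z. _ * z"] eq_commute[of i] cong: if_cong)
    also have "\<dots> = \<alpha> * v $ i + \<beta> * (u *\<^sub>v v) $ i"
      using that u v(1) by (simp add: scalar_prod_def lessThan_atLeast0)
    finally show ?thesis using v(3) that by simp
  qed
  show False
  proof (cases "\<beta> = 0")
    case True
    then have "v $ i = 0" if "i < n" for i using eq[OF that] \<alpha> by simp
    then have "v = 0\<^sub>v n" using v(1) by (intro eq_vecI) auto
    then show False using v(2) by simp
  next
    case False
    have "u *\<^sub>v v = (- \<alpha> / \<beta>) \<cdot>\<^sub>v v"
    proof (rule eq_vecI)
      fix i assume "i < dim_vec ((- \<alpha> / \<beta>) \<cdot>\<^sub>v v)"
      then have "i < n" using v(1) by simp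
      have "\<beta> * (u *\<^sub>v v) $ i = - (\<alpha> * v $ i)"
        using eq[OF \<open>i < n\<close>] by (metis add.commute add_eq_0_iff)
      then have "(u *\<^sub>v v) $ i = - (\<alpha> * v $ i) / \<beta>" using False by (metis nonzero_mult_div_cancel_left)
      then show "(u *\<^sub>v v) $ i = ((- \<alpha> / \<beta>) \<cdot>\<^sub>v v) $ i" using \<open>i < n\<close> v(1) by simp
    qed (use u v(1) in auto)
    then have "eigenvalue u (- \<alpha> / \<beta>)"
      using u v(1,2) unfolding eigenvalue_def eigenvector_def by auto
    then show False using ev[OF False] by simp
  qed
qed

lemma finite_eigenvalues:
  fixes u :: "complex mat"
  assumes u: "u \<in> carrier_mat n n"
  shows "finite {k. eigenvalue u k}"
proof -
  have "char_poly u \<noteq> 0" using degree_monic_char_poly[OF u] by auto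
  then show ?thesis using poly_roots_finite eigenvalue_root_char_poly[OF u] by auto
qed

text \<open>There are finitely many eigenvalues and infinitely many candidates. The number to avoid
  has the form \<open>- \<alpha> / \<beta>\<close> at the end of the path constructed below, where
  singularity would otherwise be possible.\<close>

lemma ex_non_eigenvalue:
  fixes u :: "complex mat"
  assumes u: "u \<in> carrier_mat n n"
  shows "\<exists>\<theta>. \<not> eigenvalue u (- (cis \<theta> * cis \<theta>))"
proof (rule ccontr)
  assume "\<not> ?thesis"
  then have "(\<lambda>\<theta>. - (cis \<theta> * cis \<theta>)) ` {0..1} \<subseteq> {k. eigenvalue u k}" by auto
  then have "finite ((\<lambda>\<theta>. - (cis \<theta> * cis \<theta>)) ` {0..1})"
    using finite_eigenvalues[OF u] finite_subset by blast
  moreover have "inj_on (\<lambda>\<theta>. - (cis \<theta> * cis \<theta>)) {0..1}"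
  proof (rule inj_onI)
    fix a b :: real assume ab: "a \<in> {0..1}" "b \<in> {0..1}" "- (cis a * cis a) = - (cis b * cis b)"
    then have "cos (2 * a) = cos (2 * b)" by (auto simp: cis_mult complex_eq_iff)
    \<comment> \<open>The parameter interval is short enough for the doubled angle to stay where the
      cosine is injective.\<close>
    moreover have "2 * a \<le> pi" "2 * b \<le> pi" using ab(1,2) pi_ge_two by auto
    ultimately have "2 * a = 2 * b" using ab(1,2) cos_inj_pi[of "2 * a" "2 * b"] by simp
    then show "a = b" by simp
  qed
  ultimately have "finite {0..1::real}" by (rule finite_imageD)
  then show False using infinite_Icc[of 0 "1::real"] by simp
qed

lemma commute_inverse_mat:
  fixes p q y :: "complex mat"
  assumes c: "p \<in> carrier_mat n n" "q \<in> carrier_mat n n" "y \<in> carrier_mat n n"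
    and pq: "p * q = 1\<^sub>m n" "q * p = 1\<^sub>m n" and py: "p * y = y * p"
  shows "q * y = y * q"
proof -
  have "q * y = q * (y * p) * q"
    using c pq by (simp add: assoc_mult_mat[of _ n n _ n _ n])
  also have "\<dots> = q * (p * y) * q" using py by simp
  also have "\<dots> = y * q" using c pq by (simp add: assoc_mult_mat[symmetric, of _ n n _ n _ n])
  finally show ?thesis .
qed

lemma commute_scalar_plus:
  fixes u y :: "complex mat"
  assumes c: "u \<in> carrier_mat n n" "y \<in> carrier_mat n n" and uy: "u * y = y * u"
  shows "(\<alpha> \<cdot>\<^sub>m 1\<^sub>m n + \<beta> \<cdot>\<^sub>m u) * y = y * (\<alpha> \<cdot>\<^sub>m 1\<^sub>m n + \<beta> \<cdot>\<^sub>m u)"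
  using c uy
  by (simp add: add_mult_distrib_mat[of _ n n _ _ n] mult_add_distrib_mat[of _ n n _ n]
      mult_smult_assoc_mat[of _ n n _ n] mult_smult_distrib[of _ n n _ n])

lemma adjoint_scalar_plus:
  assumes u: "u \<in> carrier_mat n n"
  shows "mat_adjoint (\<alpha> \<cdot>\<^sub>m 1\<^sub>m n + \<beta> \<cdot>\<^sub>m u) = cnj \<alpha> \<cdot>\<^sub>m 1\<^sub>m n + cnj \<beta> \<cdot>\<^sub>m mat_adjoint u"
proof -
  have "\<alpha> \<cdot>\<^sub>m 1\<^sub>m n + \<beta> \<cdot>\<^sub>m u \<in> carrier_mat n n" using u by auto
  from mat_adjoint_carrier[OF this] mat_adjoint_carrier[OF u] show ?thesis
    using u by (intro eq_matI) (auto simp: mat_adjoint_index)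
qed

text \<open>The matrix analogue of the fact that cnj z / z has modulus 1. Normality of
  \<open>p\<close> lets the adjoint of \<open>p\<close> pass through the inverse
  \<open>q\<close>.\<close>

lemma unitary_mult_adjoint_inverse:
  assumes u: "u \<in> carrier (unitary_group n)"
    and c: "p \<in> carrier_mat n n" "q \<in> carrier_mat n n" and pq: "p * q = 1\<^sub>m n" "q * p = 1\<^sub>m n"
    and normal: "p * mat_adjoint p = mat_adjoint p * p"
  shows "u * (mat_adjoint p * q) \<in> carrier (unitary_group n)"
proof -
  interpret group "unitary_group n" by (rule group_unitary_group)
  note c' = mat_adjoint_carrier[OF c(1)] mat_adjoint_carrier[OF c(2)]
  have qp': "q * mat_adjoint p = mat_adjoint p * q" by (rule commute_inverse_mat[OF c c'(1) pq normal])
  have "mat_adjoint (q * p) = mat_adjoint (1\<^sub>m n)" using pq by simp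
  then have pq': "mat_adjoint p * mat_adjoint q = 1\<^sub>m n"
    using c by (simp add: mat_adjoint_mult mat_adjoint_one)
  let ?w = "mat_adjoint p * q"
  have w: "?w \<in> carrier_mat n n" using c c' by simp
  have "mat_adjoint ?w = mat_adjoint q * p"
    using c c' by (simp add: mat_adjoint_mult[of _ n] mat_adjoint_adjoint)
  then have "?w * mat_adjoint ?w = q * (mat_adjoint p * mat_adjoint q) * p"
    unfolding qp'[symmetric] using c c' by (simp add: assoc_mult_mat[of _ n n _ n _ n])
  also have "\<dots> = 1\<^sub>m n" using pq' pq c by simp
  finally have ww: "?w * mat_adjoint ?w = 1\<^sub>m n" .
  then have "mat_adjoint ?w * ?w = 1\<^sub>m n"
    using mat_mult_left_right_inverse[OF w mat_adjoint_carrier[OF w]] by simp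
  then have "?w \<in> carrier (unitary_group n)" using w ww by (simp add: unitary_group_def)
  then show ?thesis using m_closed[OF u] by simp
qed

text \<open>For \<open>p = \<alpha> + \<beta> u\<close> the matrix \<open>u p\<^sup>* p\<^sup>-\<^sup>1\<close> is unitary and commutes with whatever \<open>u\<close> commutes with.
  It is \<open>u\<close> for \<open>p = 1\<close> and \<open>1\<close> for \<open>\<beta> = cnj \<alpha>\<close>.\<close>

lemma commutant_path_to_one:
  assumes u: "u \<in> commutant (unitary_group n) Y" and Y: "Y \<subseteq> carrier (unitary_group n)"
  shows "\<exists>P. connectedin (unitary_topology n) P \<and> P \<subseteq> commutant (unitary_group n) Y \<and> 1\<^sub>m n \<in> P \<and> u \<in> P"
proof -
  have uU: "u \<in> carrier (unitary_group n)" using u by (simp add: commutant_def)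
  note U = unitaryD[OF uU]
  obtain \<theta> where \<theta>: "\<not> eigenvalue u (- (cis \<theta> * cis \<theta>))" using ex_non_eigenvalue[OF U(1)] by blast
  \<comment> \<open>The coefficients run from 1 and 0 to a pair of conjugate unit numbers. Scaling
    \<open>\<beta>\<close> by \<open>t\<close> keeps the two moduli different before the
    endpoint.\<close>
  define \<alpha> where "\<alpha> t = cis (\<theta> * t)" for t
  define \<beta> where "\<beta> t = complex_of_real t * cis (- \<theta>)" for t
  define p where "p t = \<alpha> t \<cdot>\<^sub>m 1\<^sub>m n + \<beta> t \<cdot>\<^sub>m u" for t
  have p: "p t \<in> carrier_mat n n" for t unfolding p_def using U by auto
  note p' = mat_adjoint_carrier[OF p]
  have p'_eq: "mat_adjoint (p t) = cnj (\<alpha> t) \<cdot>\<^sub>m 1\<^sub>m n + cnj (\<beta> t) \<cdot>\<^sub>m mat_adjoint u" for t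
    unfolding p_def by (rule adjoint_scalar_plus[OF U(1)])
  \<comment> \<open>Before the endpoint the critical ratio has modulus different from 1 and cannot
    be an eigenvalue of a unitary matrix; at the endpoint the choice of \<open>\<theta>\<close>
    excludes it.\<close>
  have det: "det (p t) \<noteq> 0" if t: "t \<in> {0..1}" for t
  proof -
    have "\<not> eigenvalue u (- \<alpha> t / \<beta> t)" if b: "\<beta> t \<noteq> 0"
    proof (cases "t = 1")
      case True
      have "- \<alpha> t / \<beta> t = - (cis \<theta> * cis \<theta>)"
        unfolding \<alpha>_def \<beta>_def True by (simp add: cis_divide cis_mult)
      then show ?thesis using \<theta> by simp
    next
      case False
      have "cmod (- \<alpha> t / \<beta> t) = 1 / t" using t unfolding \<alpha>_def \<beta>_def by (simp add: norm_divide norm_mult)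
      also have "\<dots> \<noteq> 1" using False t by auto
      finally show ?thesis using unitary_eigenvalue_norm[OF uU] by blast
    qed
    moreover have "\<alpha> t \<noteq> 0" unfolding \<alpha>_def by simp
    ultimately show ?thesis unfolding p_def by (intro det_scalar_plus_nonzero U(1))
  qed
  \<comment> \<open>The inverse of \<open>p t\<close> in adjugate form, whose entries are visibly
    continuous in \<open>t\<close>.\<close>
  define q where "q t = (1 / det (p t)) \<cdot>\<^sub>m adj_mat (p t)" for t
  have q: "q t \<in> carrier_mat n n" for t unfolding q_def using adj_mat(1)[OF p] by auto
  have pq: "p t * q t = 1\<^sub>m n" "q t * p t = 1\<^sub>m n" if "t \<in> {0..1}" for t
  proof -
    have "(1 / det (p t)) \<cdot>\<^sub>m (det (p t) \<cdot>\<^sub>m 1\<^sub>m n) = 1\<^sub>m n"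
      using det[OF that] by (intro eq_matI) auto
    then show "p t * q t = 1\<^sub>m n" "q t * p t = 1\<^sub>m n"
      unfolding q_def using adj_mat[OF p] p
      by (simp_all add: mult_smult_distrib[of _ n n _ n] mult_smult_assoc_mat[of _ n n _ n])
  qed
  define r where "r t = u * (mat_adjoint (p t) * q t)" for t
  have uu': "mat_adjoint u * u = u * mat_adjoint u" using U by simp
  have normal: "p t * mat_adjoint (p t) = mat_adjoint (p t) * p t" for t
  proof -
    have "mat_adjoint (p t) * u = u * mat_adjoint (p t)"
      unfolding p'_eq by (rule commute_scalar_plus[OF U(2,1) uu'])
    then show ?thesis unfolding p_def[of t]
      by (intro commute_scalar_plus U(1) p'[of t, unfolded p_def]) simp
  qed
  have rU: "r t \<in> carrier (unitary_group n)" if "t \<in> {0..1}" for t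
    unfolding r_def using pq[OF that] by (intro unitary_mult_adjoint_inverse uU p q normal)
  have r_mem: "r t \<in> commutant (unitary_group n) Y" if t: "t \<in> {0..1}" for t
  proof -
    have "r t * y = y * r t" if y: "y \<in> Y" for y
    proof -
      have yc: "y \<in> carrier_mat n n" using y Y unitaryD(1) by blast
      have uy: "u * y = y * u" using u y by (simp add: commutant_def)
      have "u * mat_adjoint u = 1\<^sub>m n" "mat_adjoint u * u = 1\<^sub>m n" using U by auto
      then have u'y: "mat_adjoint u * y = y * mat_adjoint u"
        using commute_inverse_mat[OF U(1,2) yc] uy by simp
      have py: "p t * y = y * p t" unfolding p_def by (rule commute_scalar_plus[OF U(1) yc uy])
      have p'y: "mat_adjoint (p t) * y = y * mat_adjoint (p t)"
        unfolding p'_eq by (rule commute_scalar_plus[OF U(2) yc u'y])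
      have qy: "q t * y = y * q t" by (rule commute_inverse_mat[OF p q yc pq[OF t] py])
      have "r t * y = u * (mat_adjoint (p t) * (q t * y))"
        unfolding r_def using U(1) p'[of t] q[of t] yc by (simp add: assoc_mult_mat[of _ n n _ n _ n])
      also have "\<dots> = u * ((mat_adjoint (p t) * y) * q t)"
        unfolding qy using p'[of t] q[of t] yc by (simp add: assoc_mult_mat[of _ n n _ n _ n])
      also have "\<dots> = (u * y) * (mat_adjoint (p t) * q t)"
        unfolding p'y using U(1) p'[of t] q[of t] yc by (simp add: assoc_mult_mat[of _ n n _ n _ n])
      also have "\<dots> = y * r t"
        unfolding uy r_def using U(1) p'[of t] q[of t] yc by (simp add: assoc_mult_mat[of _ n n _ n _ n])
      finally show ?thesis .
    qed
    then show ?thesis using rU[OF t] by (simp add: commutant_def)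
  qed
  have r0: "r 0 = u"
  proof -
    have p0: "p 0 = 1\<^sub>m n" unfolding p_def \<alpha>_def \<beta>_def using U(1) by (intro eq_matI) auto
    then have "q 0 = 1\<^sub>m n" using pq[of 0] q[of 0] by simp
    then show ?thesis unfolding r_def p0 using U(1) by (simp add: mat_adjoint_one)
  qed
  have r1: "r 1 = 1\<^sub>m n"
  proof -
    \<comment> \<open>Multiplication by \<open>u\<close> turns the adjoint of \<open>u\<close> into
      1, so the two terms exchange their roles; with conjugate coefficients the result is
      \<open>p 1\<close> itself.\<close>
    have "u * mat_adjoint (p 1) = cnj (\<alpha> 1) \<cdot>\<^sub>m u + cnj (\<beta> 1) \<cdot>\<^sub>m 1\<^sub>m n"
      unfolding p'_eq using U by (simp add: mult_add_distrib_mat[of _ n n _ n] mult_smult_distrib[of _ n n _ n])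
    also have "\<dots> = p 1"
      unfolding p_def \<alpha>_def \<beta>_def using U(1) by (intro eq_matI) (auto simp: cis_cnj)
    finally have "u * mat_adjoint (p 1) = p 1" .
    moreover have "r 1 = (u * mat_adjoint (p 1)) * q 1"
      unfolding r_def using U(1) p'[of 1] q[of 1] by (simp add: assoc_mult_mat[of _ n n _ n _ n])
    ultimately show ?thesis using pq[of 1] by simp
  qed
  have p_cont: "continuous_on {0..1} (\<lambda>t. p t $$ (i, j))" if "i < n" "j < n" for i j
  proof -
    have "p t $$ (i, j) = cis (\<theta> * t) * (if i = j then 1 else 0) + complex_of_real t * cis (- \<theta>) * u $$ (i, j)" for t
      unfolding p_def \<alpha>_def \<beta>_def using that U(1) by simp
    then show ?thesis by (auto intro!: continuous_intros)
  qed
  have p'_cont: "continuous_on {0..1} (\<lambda>t. mat_adjoint (p t) $$ (i, j))" if "i < n" "j < n" for i j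
  proof -
    have "mat_adjoint (p t) $$ (i, j) = cnj (p t $$ (j, i))" for t
      using p[of t] that by (simp add: mat_adjoint_index)
    then show ?thesis using p_cont that by (auto intro!: continuous_intros)
  qed
  have q_cont: "continuous_on {0..1} (\<lambda>t. q t $$ (i, j))" if "i < n" "j < n" for i j
  proof -
    have "q t $$ (i, j) = (1 / det (p t)) * adj_mat (p t) $$ (i, j)" for t
      unfolding q_def using adj_mat(1)[OF p, of t] that by simp
    moreover have "continuous_on {0..1} (\<lambda>t. (1 / det (p t)) * adj_mat (p t) $$ (i, j))"
      using det p_cont that
      by (intro continuous_intros continuous_on_det[of _ _ n] continuous_on_adj_mat[of _ _ n] p) auto
    ultimately show ?thesis by simp
  qed
  have r_cont: "continuous_on {0..1} (\<lambda>t. r t $$ (i, j))" if "i < n" "j < n" for i j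
    unfolding r_def using that U(1) p' q
    by (intro continuous_on_mat_mult[where n = n] p'_cont q_cont continuous_on_const mult_carrier_mat) auto
  have "continuous_map (top_of_set {0..1}) (unitary_topology n) r"
    unfolding unitary_topology_def
  proof (rule continuous_map_pullback')
    show "continuous_map (top_of_set {0..1}) (product_topology (\<lambda>_. euclidean) ({..<n} \<times> {..<n}))
        ((\<lambda>U. \<lambda>ij\<in>{..<n} \<times> {..<n}. U $$ ij) \<circ> r)"
      unfolding continuous_map_componentwise using r_cont by (auto simp: o_def)
    show "topspace (top_of_set {0..1}) \<subseteq> r -` carrier (unitary_group n)" using rU by auto
  qed
  moreover have "connectedin (top_of_set {0..1::real}) {0..1}"
    by (simp add: connectedin_subtopology connectedin_iff_connected)
  ultimately have "connectedin (unitary_topology n) (r ` {0..1})"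
    by (rule connectedin_continuous_map_image)
  moreover have "r ` {0..1} \<subseteq> commutant (unitary_group n) Y" using r_mem by auto
  moreover have "1\<^sub>m n \<in> r ` {0..1}" "u \<in> r ` {0..1}" using imageI[of 1 "{0..1}" r] imageI[of 0 "{0..1}" r] r0 r1 by auto
  ultimately show ?thesis by blast
qed

text \<open>Each element lies in a connected subset through the identity, and the union of connected
  sets with a common point is connected.\<close>

lemma connectedin_commutant:
  assumes Y: "Y \<subseteq> carrier (unitary_group n)"
  shows "connectedin (unitary_topology n) (commutant (unitary_group n) Y)"
proof -
  define \<P> where "\<P> = {P. connectedin (unitary_topology n) P \<and> P \<subseteq> commutant (unitary_group n) Y \<and> 1\<^sub>m n \<in> P}"
  have "commutant (unitary_group n) Y = \<Union>\<P>"
    unfolding \<P>_def using commutant_path_to_one[OF _ Y] by blast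
  moreover have "connectedin (unitary_topology n) (\<Union>\<P>)"
    by (rule connectedin_Union) (auto simp: \<P>_def)
  ultimately show ?thesis by simp
qed

section \<open>Numerical estimate and conclusion\<close>

text \<open>With \<open>Suc n \<le> 2 * n\<close> and \<open>2 * n + 4 \<le> 6 * n\<close> the left
  side is at most (16n + 1)^(8n^4) K^(56n^2), where 56 = 12 + 44. The constant 100 is dictated by
  \<open>n = 1\<close>: there every power of \<open>n\<close> is 1, and 17^8 has to be absorbed by
  further powers of \<open>K\<close>.\<close>

lemma index_bound_le:
  fixes K :: real and n :: nat
  assumes n: "1 \<le> n" and K: "2 \<le> K"
  shows "(K ^ (2 * n + 4) * (real ((16 * n + 1) ^ (2 * n ^ 2)) * K ^ 11) ^ Suc n) ^ Suc n
    \<le> real n powr (100 * real n ^ 4) * K powr (100 * real n ^ 2)"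
proof -
  define N where "N = (16 * real n + 1) ^ (2 * n ^ 2)"
  have N_eq: "real ((16 * n + 1) ^ (2 * n ^ 2)) = N" unfolding N_def by (simp add: add.commute)
  have N: "1 \<le> N" unfolding N_def by simp
  have NK: "1 \<le> N * K ^ 11" using N K mult_mono[of 1 N 1 "K ^ 11"] by simp
  have B1: "1 \<le> K ^ (2 * n + 4) * (N * K ^ 11) ^ Suc n"
    using mult_mono[of 1 "K ^ (2 * n + 4)" 1 "(N * K ^ 11) ^ Suc n"] one_le_power[OF NK, of "Suc n"]
      one_le_power[of K "2 * n + 4"] K by linarith
  have "(K ^ (2 * n + 4) * (N * K ^ 11) ^ Suc n) ^ Suc n \<le> (K ^ (2 * n + 4) * (N * K ^ 11) ^ Suc n) ^ (2 * n)"
    using n B1 by (intro power_increasing) auto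
  also have "\<dots> \<le> (K ^ (6 * n) * (N * K ^ 11) ^ (2 * n)) ^ (2 * n)"
    using n NK K N by (intro power_mono mult_mono power_increasing) auto
  also have "\<dots> = N ^ (2 * n * (2 * n)) * K ^ (6 * n * (2 * n) + 11 * (2 * n) * (2 * n))"
    by (simp only: power_mult_distrib power_mult[symmetric] power_add mult_ac)
  also have "2 * n * (2 * n) = 4 * n ^ 2" by (simp add: power2_eq_square)
  also have "6 * n * (2 * n) + 11 * (2 * n) * (2 * n) = 56 * n ^ 2" by (simp add: power2_eq_square)
  also have "N ^ (4 * n ^ 2) = (16 * real n + 1) ^ (8 * n ^ 4)"
    unfolding N_def by (simp add: power_mult[symmetric] power_add[symmetric])
  finally have main: "(K ^ (2 * n + 4) * (N * K ^ 11) ^ Suc n) ^ Suc n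
      \<le> (16 * real n + 1) ^ (8 * n ^ 4) * K ^ (56 * n ^ 2)" .
  have rhs: "real n powr (100 * real n ^ 4) = real n ^ (100 * n ^ 4)"
    "K powr (100 * real n ^ 2) = K ^ (100 * n ^ 2)"
    using n K powr_realpow[of "real n" "100 * n ^ 4"] powr_realpow[of K "100 * n ^ 2"] by simp_all
  have "(16 * real n + 1) ^ (8 * n ^ 4) * K ^ (56 * n ^ 2) \<le> real n ^ (100 * n ^ 4) * K ^ (100 * n ^ 2)"
  proof (cases "n = 1")
    case True
    \<comment> \<open>The exponent 44 is what remains of 100 after the 56 factors of
      \<open>K\<close>; this is where \<open>K\<close> being at least 2 matters.\<close>
    have "(17::real) ^ 8 \<le> 2 ^ 44" by simp
    also have "\<dots> \<le> K ^ 44" using K by (intro power_mono) auto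
    finally have "17 ^ 8 * K ^ 56 \<le> K ^ 44 * K ^ 56" using K by (intro mult_right_mono) auto
    then show ?thesis using True by (simp add: power_add[symmetric])
  next
    case False
    then have n2: "2 \<le> real n" using n by simp
    \<comment> \<open>For \<open>n\<close> at least 2 the constant is swallowed by powers of
      \<open>n\<close>: the base is at most n^6, and 6 * 8 = 48 is below 100.\<close>
    have "16 * real n + 1 \<le> 2 ^ 5 * real n" using n2 by simp
    also have "\<dots> \<le> real n ^ 5 * real n" using n2 by (intro mult_right_mono power_mono) auto
    also have "\<dots> = real n ^ 6" by (simp add: eval_nat_numeral)
    finally have "(16 * real n + 1) ^ (8 * n ^ 4) \<le> (real n ^ 6) ^ (8 * n ^ 4)" by (intro power_mono) auto
    also have "\<dots> \<le> real n ^ (100 * n ^ 4)"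
      unfolding power_mult[symmetric] using n2 by (intro power_increasing) auto
    finally show ?thesis using n K by (intro mult_mono power_increasing) auto
  qed
  then show ?thesis unfolding N_eq rhs using main by linarith
qed

theorem corollary1p4:
  shows "\<exists>C::real. C > 0 \<and>
    (\<forall>(n::nat) (K::real) (A::complex mat set).
       n \<ge> 1 \<longrightarrow> K \<ge> 2 \<longrightarrow> approximate_group (unitary_group n) K A \<longrightarrow>
       (\<exists>S. subgroup S (unitary_group n) \<and>
            comm_group ((unitary_group n)\<lparr>carrier := S\<rparr>) \<and>
            connectedin (unitary_topology n) S \<and>
            A \<subseteq> normalizer (unitary_group n) S \<and>
            real (card ((\<lambda>a. S #>\<^bsub>unitary_group n\<^esub> a) ` A))
              \<le> real n powr (C * real n ^ 4) * K powr (C * real n ^ 2)))"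
proof (intro exI[of _ 100] conjI allI impI)
  fix n :: nat and K :: real and A :: "complex mat set"
  assume n: "n \<ge> 1" and K: "K \<ge> 2" and A: "approximate_group (unitary_group n) K A"
  let ?U = "unitary_group n" and ?N = "real ((16 * n + 1) ^ (2 * n ^ 2))"
  interpret group ?U by (rule group_unitary_group)
  \<comment> \<open>The distance to the identity in the Frobenius norm serves as
    \<open>\<nu>\<close>, the number of boxes as \<open>N\<close>, and the dimension as the bound on
    chains.\<close>
  interpret small_commutators ?U A K "\<lambda>x. frob (x - 1\<^sub>m n)" ?N n
  proof unfold_locales
    show "approximate_group ?U K A" by (rule A)
    show "1 \<le> ?N" by simp
  next
    fix x assume x: "x \<in> carrier ?U"
    show "0 \<le> frob (x - 1\<^sub>m n)" by (rule frob_nonneg)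
    note X = unitaryD(1)[OF x]
    assume "frob (x - 1\<^sub>m n) = 0"
    then have x0: "x - 1\<^sub>m n = 0\<^sub>m n n" using X by (intro frob_eq_0) (auto intro: minus_carrier_mat)
    have "x = 1\<^sub>m n"
    proof (rule eq_matI)
      fix i j assume "i < dim_row (1\<^sub>m n)" "j < dim_col (1\<^sub>m n)"
      then have ij: "i < n" "j < n" by auto
      have "(x - 1\<^sub>m n) $$ (i, j) = 0" using x0 ij by simp
      then show "x $$ (i, j) = 1\<^sub>m n $$ (i, j)" using X ij by simp
    qed (use X in auto)
    then show "x = \<one>\<^bsub>?U\<^esub>" by simp
  next
    fix x y assume xy: "x \<in> carrier ?U" "y \<in> carrier ?U"
    show "frob (inv\<^bsub>?U\<^esub> x \<otimes>\<^bsub>?U\<^esub> y - 1\<^sub>m n) \<le> frob (x - 1\<^sub>m n) + frob (y - 1\<^sub>m n)"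
      using frob_quotient_le[OF xy] xy by simp
    show "frob (x \<otimes>\<^bsub>?U\<^esub> y \<otimes>\<^bsub>?U\<^esub> inv\<^bsub>?U\<^esub> x \<otimes>\<^bsub>?U\<^esub> inv\<^bsub>?U\<^esub> y - 1\<^sub>m n)
        \<le> 2 * frob (x - 1\<^sub>m n) * frob (y - 1\<^sub>m n)"
      using frob_commutator_le[OF xy] xy by simp
  next
    fix x w c assume "x \<in> carrier ?U" "w \<in> carrier ?U" "frob (w - 1\<^sub>m n) < 1"
      "c = x \<otimes>\<^bsub>?U\<^esub> w \<otimes>\<^bsub>?U\<^esub> inv\<^bsub>?U\<^esub> x \<otimes>\<^bsub>?U\<^esub> inv\<^bsub>?U\<^esub> w" "c \<otimes>\<^bsub>?U\<^esub> x = x \<otimes>\<^bsub>?U\<^esub> c"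
    then show "c = \<one>\<^bsub>?U\<^esub>" using central_commutator_eq_one[of x n w c] by simp
  next
    fix F assume F: "finite F" "F \<subseteq> carrier ?U"
    obtain F' where "F' \<subseteq> F" "real (card F) \<le> ?N * card F'"
      "\<forall>x\<in>F'. \<forall>y\<in>F'. frob (mat_adjoint x * y - 1\<^sub>m n) \<le> 1/5"
      using unitary_cover[OF n F] by blast
    moreover have "inv\<^bsub>?U\<^esub> x = mat_adjoint x" if "x \<in> F'" for x
      using that \<open>F' \<subseteq> F\<close> F(2) by (intro inv_unitary) auto
    ultimately show "\<exists>F'\<subseteq>F. real (card F) \<le> ?N * card F' \<and>
        (\<forall>x\<in>F'. \<forall>y\<in>F'. frob (inv\<^bsub>?U\<^esub> x \<otimes>\<^bsub>?U\<^esub> y - 1\<^sub>m n) \<le> 1/5)"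
      by (intro exI[of _ F']) auto
  next
    show "k \<le> n" if "commuting_chain ?U g h k" for g h k
      using that by (rule commuting_chain_unitary_le)
  qed
  obtain Y where Y: "Y \<subseteq> carrier ?U" "A \<subseteq> normalizer ?U (commutant ?U Y)"
    "\<forall>u\<in>commutant ?U Y. \<forall>v\<in>commutant ?U Y. u \<otimes>\<^bsub>?U\<^esub> v = v \<otimes>\<^bsub>?U\<^esub> u"
    "real (card ((\<lambda>a. commutant ?U Y #>\<^bsub>?U\<^esub> a) ` A))
      \<le> (K ^ (2 * n + 4) * (?N * K ^ 11) ^ Suc n) ^ Suc n"
    using almost_abelian by blast
  let ?S = "commutant ?U Y"
  have S: "subgroup ?S ?U" by (rule subgroup_commutant[OF Y(1)])
  have "comm_group (?U\<lparr>carrier := ?S\<rparr>)"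
    using subgroup_imp_group[OF S] Y(3) by (intro group.group_comm_groupI) auto
  moreover have "real (card ((\<lambda>a. ?S #>\<^bsub>?U\<^esub> a) ` A))
      \<le> real n powr (100 * real n ^ 4) * K powr (100 * real n ^ 2)"
    using Y(4) index_bound_le[OF n K] by (rule order_trans)
  ultimately show "\<exists>S. subgroup S ?U \<and> comm_group (?U\<lparr>carrier := S\<rparr>) \<and>
      connectedin (unitary_topology n) S \<and> A \<subseteq> normalizer ?U S \<and>
      real (card ((\<lambda>a. S #>\<^bsub>?U\<^esub> a) ` A)) \<le> real n powr (100 * real n ^ 4) * K powr (100 * real n ^ 2)"
    using S connectedin_commutant[OF Y(1)] Y(2) by blast
qed simp

end
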